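(* Let $\mathbf{X}=(X_n)_{n\in\mathbb{Z}}$ and $\mathbf{Y}=(Y_n)_{n\in\mathbb{Z}}$ be two stationary chains of infinite order on $\mathcal{A}=\{0,1\}$ with transition probabilities $p^X$ and $p^Y$ such that: $p^X(1\mid x_{-\infty}^{-1})\le p^Y(1\mid y_{-\infty}^{-1})$ whenever $x_{-\infty}^{-1}\le y_{-\infty}^{-1}$ (ordering); $\max\{\beta^X(k),\beta^Y(k)\}\to0$ as $k\to\infty$, where $\beta^X(k)=\max_{a\in\mathcal{A}}\sup\{|p^X(a\mid x_{-\infty}^{-1})-p^X(a\mid y_{-\infty}^{-1})|: x_{-k}^{-1}=y_{-k}^{-1}\}$ and similarly for $\beta^Y$ (continuity); and $\prod_{k\ge0}\alpha_k>0$, where the numbers $\alpha_k$ are defined from $p^X$ and $p^Y$ as in the context. Let $(L_n)_{n\in\mathbb{Z}}$, the random times $(T_n)_{n\in\mathbb{Z}}$ and the bivariate process $(\hat X_n,\hat Y_n)_{n\in\mathbb{Z}}$ be as constructed in the context. Then the sequence of random times $\dots<T_{-1}<T_0\le0<T_1<T_2<\dots$ satisfies: (i) $\mathbb{P}$-almost surely, all the random times $T_n$, $n\in\mathbb{Z}$, are finite. (ii) The random pairs of strings $(\hat X_{T_i}^{T_{i+1}-1},\hat Y_{T_i}^{T_{i+1}-1})$, $i\neq0$, are mutually independent and identically distributed, and the pair of strings $(\hat X_{T_0}^{T_1-1},\hat Y_{T_0}^{T_1-1})$ is independent of the others.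
   Context: **Chains.** For integers $m\le n$, $x_m^n=(x_m,\dots,x_n)$; $x_{-\infty}^{-1}=(x_i)_{i\le -1}$ is called a past, and $\mathcal{A}_{-\infty}^{-1}$ is the set of pasts. $\mathbb{N}=\{0,1,2,\dots\}$. That $\mathbf{X}$ is a stationary chain of infinite order with transition probabilities $p^X$ means that $\mathbf X$ is stationary and $p^X(a\mid x_{-\infty}^{-1})$ is a (regular) version of $\mathbb{P}(X_0=a\mid X_{-\infty}^{-1}=x_{-\infty}^{-1})$, defined for every past and every $a\in\mathcal{A}$; similarly for $\mathbf{Y}$ and $p^Y$. Write $x_{-\infty}^{-1}\le y_{-\infty}^{-1}$ if $x_n\le y_n$ for all $n\le -1$. **Coupled kernel.** Let $\mathcal{S}=\{(0,0),(0,1),(1,1)\}$; $\mathcal{S}_{-\infty}^{-1}$ (resp. $\mathcal{S}_{-k}^{-1}$) is the set of $\mathcal S$-valued sequences indexed by $i\le-1$ (resp. $-k\le i\le -1$), identified with ordered pairs of pasts (resp. strings) $(x,y)$. For $(x_{-\infty}^{-1},y_{-\infty}^{-1})\in\mathcal{S}_{-\infty}^{-1}$ define $P((1,1)\mid(x_{-\infty}^{-1},y_{-\infty}^{-1}))=p^X(1\mid x_{-\infty}^{-1})$, $P((0,0)\mid(x_{-\infty}^{-1},y_{-\infty}^{-1}))=p^Y(0\mid y_{-\infty}^{-1})$, $P((0,1)\mid(x_{-\infty}^{-1},y_{-\infty}^{-1}))=p^X(0\mid x_{-\infty}^{-1})-p^Y(0\mid y_{-\infty}^{-1})$. For $(a,b)\in\mathcal{S}$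 put $r_0((a,b))=\inf\{P((a,b)\mid w): w\in\mathcal{S}_{-\infty}^{-1}\}$, and for $k\ge1$, $r_k((a,b)\mid(x_{-k}^{-1},y_{-k}^{-1}))=\inf\{P((a,b)\mid(u_{-\infty}^{-1},v_{-\infty}^{-1})):(u_{-\infty}^{-1},v_{-\infty}^{-1})\in\mathcal{S}_{-\infty}^{-1},\,u_{-k}^{-1}=x_{-k}^{-1},\,v_{-k}^{-1}=y_{-k}^{-1}\}$. Put $\alpha_0=\sum_{(a,b)\in\mathcal{S}}r_0((a,b))$ and, for $k\ge1$, $\alpha_k=\inf\{\sum_{(a,b)\in\mathcal{S}}r_k((a,b)\mid(x_{-k}^{-1},y_{-k}^{-1})):(x_{-k}^{-1},y_{-k}^{-1})\in\mathcal{S}_{-k}^{-1}\}$. **Construction.** Let $\lambda_0=\alpha_0$ and $\lambda_k=\alpha_k-\alpha_{k-1}$ for $k\ge1$; since $\max\{\beta^X(k),\beta^Y(k)\}\to0$, $(\lambda_k)_{k\in\mathbb{N}}$ is a probability distribution. Fix a probability measure $P_0$ on $\mathcal{S}$ and transition probabilities $P_k$ on $\mathcal{S}\times\mathcal{S}_{-k}^{-1}$, $k\ge1$, such that for all $(a,b)\in\mathcal{S}$ and $(x_{-\infty}^{-1},y_{-\infty}^{-1})\in\mathcal{S}_{-\infty}^{-1}$, $$P((a,b)\mid(x_{-\infty}^{-1},y_{-\infty}^{-1}))=\lambda_0P_0((a,b))+\sum_{k\ge1}\lambda_kP_k((a,b)\mid(x_{-k}^{-1},y_{-k}^{-1})).$$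 Let $(L_n)_{n\in\mathbb{Z}}$ be iid with $\mathbb{P}(L_n=k)=\lambda_k$, $k\in\mathbb N$. Let $T_0=\sup\{z\le0: L_{z+m}\le m\ \forall m\ge0\}$ and, for $n\ge1$, $T_{-n}=\sup\{z<T_{-n+1}: L_{z+m}\le m\ \forall m\ge0\}$, $T_n=\inf\{z>T_{n-1}: L_{z+m}\le m\ \forall m\ge0\}$ (with $\sup\emptyset=-\infty$, $\inf\emptyset=+\infty$). Given $(L_n)_{n\in\mathbb Z}$, and hence $(T_j)_{j\in\mathbb Z}$, the strings $(\hat X_{T_j}^{T_{j+1}-1},\hat Y_{T_j}^{T_{j+1}-1})$, $j\in\mathbb{Z}$, are generated (on the event that all $T_j$ are finite) independently of each other conditionally on $(L_n)_{n\in\mathbb{Z}}$, each as follows: (1) choose $(\hat X_{T_j},\hat Y_{T_j})\in\mathcal{S}$ with law $P_0$; (2) successively for $n=T_j+1,\dots,T_{j+1}-1$, choose $(\hat X_n,\hat Y_n)\in\mathcal{S}$ with law $P_{L_n}(\cdot\mid(\hat X_{n-L_n}^{n-1},\hat Y_{n-L_n}^{n-1}))$ (law $P_0$ if $L_n=0$); here $n-L_n\ge T_j$ for $T_j\le n<T_{j+1}$. The strings in (ii) are regarded as random elements of the countable set of finite $\mathcal{S}$-valued strings (of random length $T_{i+1}-T_i$). *)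

theory Defs
  imports "HOL-Probability.Probability"
begin

text \<open>
  The alphabet is \<^typ>\<open>bool\<close>, with \<^term>\<open>False\<close> for 0 and \<^term>\<open>True\<close> for 1.
  A past is a function on \<^typ>\<open>nat\<close> whose value at \<open>i\<close> is the symbol at time \<open>-1 - i\<close>;
  the pointwise order on functions is the order on pasts.
  Finite strings are lists in chronological order, the oldest symbol first.
\<close>

type_synonym past = "nat \<Rightarrow> bool"

abbreviation past_space :: "past measure" where
  "past_space \<equiv> PiM UNIV (\<lambda>_. count_space UNIV)"

definition past_of :: "(int \<Rightarrow> 'w \<Rightarrow> bool) \<Rightarrow> 'w \<Rightarrow> past" where
  "past_of X \<omega> = (\<lambda>i. X (- 1 - int i) \<omega>)"

definition stationary_chain ::
    "'w measure \<Rightarrow> (int \<Rightarrow> 'w \<Rightarrow> bool) \<Rightarrow> (past \<Rightarrow> bool pmf) \<Rightarrow> bool" where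
  "stationary_chain M X p \<longleftrightarrow>
     prob_space M \<and>
     (\<forall>n. X n \<in> measurable M (count_space UNIV)) \<and>
     (\<forall>h. distr M (PiM UNIV (\<lambda>_. count_space UNIV)) (\<lambda>\<omega> n. X (n + h) \<omega>) =
          distr M (PiM UNIV (\<lambda>_. count_space UNIV)) (\<lambda>\<omega> n. X n \<omega>)) \<and>
     (\<forall>a. (\<lambda>x. pmf (p x) a) \<in> borel_measurable past_space) \<and>
     (\<forall>a. AE \<omega> in M.
        real_cond_exp M (vimage_algebra (space M) (past_of X) past_space)
          (indicator {\<omega>' \<in> space M. X 0 \<omega>' = a}) \<omega> = pmf (p (past_of X \<omega>)) a)"

definition \<beta> :: "(past \<Rightarrow> bool pmf) \<Rightarrow> nat \<Rightarrow> real" where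
  "\<beta> p k = Max (range (\<lambda>a.
     Sup {\<bar>pmf (p x) a - pmf (p y) a\<bar> | x y. \<forall>i<k. x i = y i}))"

definition \<S> :: "(bool \<times> bool) set" where
  "\<S> = {(False, False), (False, True), (True, True)}"

definition S_pasts :: "(past \<times> past) set" where
  "S_pasts = {(x, y). \<forall>i. (x i, y i) \<in> \<S>}"

definition S_strings :: "nat \<Rightarrow> (bool \<times> bool) list set" where
  "S_strings k = {s. length s = k \<and> set s \<subseteq> \<S>}"

definition recent :: "nat \<Rightarrow> past \<times> past \<Rightarrow> (bool \<times> bool) list" where
  "recent k w = map (\<lambda>i. (fst w i, snd w i)) (rev [0..<k])"

text \<open>The value at \<open>(True, False)\<close>, a pair outside \<^const>\<open>\<S>\<close>, is never used.\<close>

fun coupled_kernel ::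
    "(past \<Rightarrow> bool pmf) \<Rightarrow> (past \<Rightarrow> bool pmf) \<Rightarrow> bool \<times> bool \<Rightarrow> past \<times> past \<Rightarrow> real" where
  "coupled_kernel pX pY (True, True) (x, y) = pmf (pX x) True"
| "coupled_kernel pX pY (False, False) (x, y) = pmf (pY y) False"
| "coupled_kernel pX pY (False, True) (x, y) = pmf (pX x) False - pmf (pY y) False"
| "coupled_kernel pX pY (True, False) (x, y) = 0"

text \<open>
  The index \<open>k\<close> of \<open>r\<^sub>k\<close> is the length of the string; the empty string imposes no constraint
  on the past and gives \<open>r\<^sub>0\<close>, and the only string of length 0 is the empty one, so that
  \<open>\<alpha> 0\<close> is the sum of the values of \<open>r\<^sub>0\<close>.
\<close>

definition r_inf ::
    "(past \<Rightarrow> bool pmf) \<Rightarrow> (past \<Rightarrow> bool pmf) \<Rightarrow> bool \<times> bool \<Rightarrow> (bool \<times> bool) list \<Rightarrow> real" where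
  "r_inf pX pY ab s =
     Inf {coupled_kernel pX pY ab w | w. w \<in> S_pasts \<and> recent (length s) w = s}"

definition \<alpha> :: "(past \<Rightarrow> bool pmf) \<Rightarrow> (past \<Rightarrow> bool pmf) \<Rightarrow> nat \<Rightarrow> real" where
  "\<alpha> pX pY k = (INF s\<in>S_strings k. \<Sum>ab\<in>\<S>. r_inf pX pY ab s)"

definition lam :: "(past \<Rightarrow> bool pmf) \<Rightarrow> (past \<Rightarrow> bool pmf) \<Rightarrow> nat \<Rightarrow> real" where
  "lam pX pY k = (if k = 0 then \<alpha> pX pY 0 else \<alpha> pX pY k - \<alpha> pX pY (k - 1))"

definition kernel_decomposition ::
    "(past \<Rightarrow> bool pmf) \<Rightarrow> (past \<Rightarrow> bool pmf) \<Rightarrow> (bool \<times> bool) pmf \<Rightarrow>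
     (nat \<Rightarrow> (bool \<times> bool) list \<Rightarrow> (bool \<times> bool) pmf) \<Rightarrow> bool" where
  "kernel_decomposition pX pY P0 K \<longleftrightarrow>
     set_pmf P0 \<subseteq> \<S> \<and>
     (\<forall>k\<ge>1. \<forall>s\<in>S_strings k. set_pmf (K k s) \<subseteq> \<S>) \<and>
     (\<forall>ab\<in>\<S>. \<forall>w\<in>S_pasts.
        (\<lambda>k. lam pX pY (Suc k) * pmf (K (Suc k) (recent (Suc k) w)) ab) sums
          (coupled_kernel pX pY ab w - lam pX pY 0 * pmf P0 ab))"

definition regen :: "(int \<Rightarrow> nat) \<Rightarrow> int \<Rightarrow> bool" where
  "regen l z \<longleftrightarrow> (\<forall>m. l (z + int m) \<le> m)"

text \<open>
  \<open>regen_back l n\<close> is the time with index \<open>-n\<close>.  In \<^typ>\<open>ereal\<close> the supremum of the empty set is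
  \<open>-\<infinity>\<close> and its infimum is \<open>\<infinity>\<close>.
\<close>

primrec regen_back :: "(int \<Rightarrow> nat) \<Rightarrow> nat \<Rightarrow> ereal" where
  "regen_back l 0 = Sup {ereal (of_int z) | z. z \<le> 0 \<and> regen l z}"
| "regen_back l (Suc n) = Sup {ereal (of_int z) | z. ereal (of_int z) < regen_back l n \<and> regen l z}"

primrec regen_forw :: "(int \<Rightarrow> nat) \<Rightarrow> nat \<Rightarrow> ereal" where
  "regen_forw l 0 = regen_back l 0"
| "regen_forw l (Suc n) = Inf {ereal (of_int z) | z. ereal (of_int z) > regen_forw l n \<and> regen l z}"

definition regen_time :: "(int \<Rightarrow> nat) \<Rightarrow> int \<Rightarrow> ereal" where
  "regen_time l n = (if n \<le> 0 then regen_back l (nat (- n)) else regen_forw l (nat n))"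

definition regen_time_int :: "(int \<Rightarrow> nat) \<Rightarrow> int \<Rightarrow> int" where
  "regen_time_int l n = \<lfloor>real_of_ereal (regen_time l n)\<rfloor>"

text \<open>
  Law of the first \<open>m\<close> symbols generated from time \<open>t\<close> on, given the values \<open>l\<close> of the
  process \<open>L\<close>.  At time \<open>t + m\<close> the kernel of order \<open>l (t + m)\<close> is applied to that many
  last symbols of the string generated so far.
\<close>

primrec string_law ::
    "(bool \<times> bool) pmf \<Rightarrow> (nat \<Rightarrow> (bool \<times> bool) list \<Rightarrow> (bool \<times> bool) pmf) \<Rightarrow>
     (int \<Rightarrow> nat) \<Rightarrow> int \<Rightarrow> nat \<Rightarrow> (bool \<times> bool) list pmf" where
  "string_law P0 K l t 0 = return_pmf []"
| "string_law P0 K l t (Suc m) =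
     bind_pmf (string_law P0 K l t m) (\<lambda>s.
       map_pmf (\<lambda>ab. s @ [ab])
         (let k = l (t + int m)
          in if m = 0 \<or> k = 0 then P0 else K k (drop (length s - k) s)))"

definition block ::
    "(int \<Rightarrow> 'w \<Rightarrow> nat) \<Rightarrow> (int \<Rightarrow> 'w \<Rightarrow> bool) \<Rightarrow> (int \<Rightarrow> 'w \<Rightarrow> bool) \<Rightarrow>
     int \<Rightarrow> 'w \<Rightarrow> (bool \<times> bool) list" where
  "block L Xh Yh j \<omega> =
     map (\<lambda>n. (Xh n \<omega>, Yh n \<omega>)) [regen_time_int (\<lambda>n. L n \<omega>) j .. regen_time_int (\<lambda>n. L n \<omega>) (j + 1) - 1]"

text \<open>
  Conditionally on \<open>L\<close>, and on the event that all the times are finite, the blocks are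
  independent and the \<open>j\<close>-th one has law \<^const>\<open>string_law\<close>.  As the blocks are discrete, this
  is expressed by the conditional probabilities that finitely many of them take given values.
\<close>

definition generated_blocks ::
    "'w measure \<Rightarrow> (int \<Rightarrow> 'w \<Rightarrow> nat) \<Rightarrow> (int \<Rightarrow> 'w \<Rightarrow> bool) \<Rightarrow> (int \<Rightarrow> 'w \<Rightarrow> bool) \<Rightarrow>
     (bool \<times> bool) pmf \<Rightarrow> (nat \<Rightarrow> (bool \<times> bool) list \<Rightarrow> (bool \<times> bool) pmf) \<Rightarrow> bool" where
  "generated_blocks M L Xh Yh P0 K \<longleftrightarrow>
     (\<forall>n. Xh n \<in> measurable M (count_space UNIV)) \<and>
     (\<forall>n. Yh n \<in> measurable M (count_space UNIV)) \<and>
     (\<forall>J s. finite J \<longrightarrow>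
       (AE \<omega> in M. (\<forall>j. \<bar>regen_time (\<lambda>n. L n \<omega>) j\<bar> \<noteq> \<infinity>) \<longrightarrow>
          real_cond_exp M
            (vimage_algebra (space M) (\<lambda>\<omega>' n. L n \<omega>') (PiM UNIV (\<lambda>_. count_space UNIV)))
            (indicator {\<omega>' \<in> space M. \<forall>j\<in>J. block L Xh Yh j \<omega>' = s j}) \<omega> =
          (\<Prod>j\<in>J. pmf (string_law P0 K (\<lambda>n. L n \<omega>) (regen_time_int (\<lambda>n. L n \<omega>) j)
              (nat (regen_time_int (\<lambda>n. L n \<omega>) (j + 1) - regen_time_int (\<lambda>n. L n \<omega>) j))) (s j))))"

end

theory Submission
  imports Defs
begin

text \<open>
  If \<open>e\<close> is a regeneration time, whether an earlier time is one depends only on the values of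
  \<open>L\<close> before \<open>e\<close>.  Hence, with \<open>c = (\<Prod>k. \<alpha> k)\<close> the probability of regenerating at a given
  time, the event that prescribed words \<open>v\<^sub>1, \<dots>, v\<^sub>r\<close> of values of \<open>L\<close> fill consecutive
  regeneration cycles from a given time on has probability \<open>c\<close> times the product of the
  masses of all their letters.  The cycle around the origin can start at as many places as
  its word is long, so the words of the cycles with indices in \<open>{-N..N}\<close> have joint mass
  \<open>c \<bar>v\<^sub>0\<bar> \<Prod>\<^sub>j p(v\<^sub>j)\<close>: they are independent, and
  identically distributed except for the size-biased one with index 0.  Given \<open>L\<close>, the
  strings are independent and the law of each depends only on its own word, so their
  independence follows by taking expectations.

  For (i), Kolmogorov's 0-1 law gives infinitely many regeneration times to the right.  The
  probability that no regeneration time is below \<open>h\<close> does not depend on \<open>h\<close>, by stationarity,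
  and tends to 0 as \<open>h\<close> tends to infinity, so there are infinitely many to the left, too.
\<close>

subsection \<open>Regeneration times of a fixed sequence\<close>

definition segment :: "(int \<Rightarrow> 'a) \<Rightarrow> int \<Rightarrow> nat \<Rightarrow> 'a list" where
  "segment l s n = map (\<lambda>i. l (s + int i)) [0..<n]"

text \<open>
  For a word followed by a regeneration time, the first inequality makes its start one as well,
  and the second one excludes any other strictly inside.
\<close>

definition cycle_words :: "nat list set" where
  "cycle_words = {v. v \<noteq> [] \<and> (\<forall>i<length v. v ! i \<le> i) \<and>
     (\<forall>i. 0 < i \<and> i < length v \<longrightarrow> (\<exists>k. i \<le> k \<and> k < length v \<and> k - i < v ! k))}"

definition recurrent :: "(int \<Rightarrow> nat) \<Rightarrow> bool" where
  "recurrent l \<longleftrightarrow> (\<forall>n. (\<exists>z\<le>n. regen l z) \<and> (\<exists>z\<ge>n. regen l z))"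

text \<open>At most one \<open>T\<close> satisfies this, since the last line fixes the indexing.
  Integer values keep the combinatorics of cycles apart from the \<open>ereal\<close>-valued suprema
  and infima.\<close>

definition enumerates :: "(int \<Rightarrow> nat) \<Rightarrow> (int \<Rightarrow> int) \<Rightarrow> bool" where
  "enumerates l T \<longleftrightarrow>
     (\<forall>j. regen l (T j) \<and> T j < T (j + 1) \<and> (\<forall>z. T j < z \<and> z < T (j + 1) \<longrightarrow> \<not> regen l z)) \<and>
     T 0 \<le> 0 \<and> 0 < T 1"

text \<open>Regeneration is imposed at the right end; \<open>cycle_words\<close> then carries it
  back to the start of every word.\<close>

primrec cycles_from :: "(int \<Rightarrow> nat) \<Rightarrow> int \<Rightarrow> nat list list \<Rightarrow> bool" where
  "cycles_from l s [] \<longleftrightarrow> regen l s"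
| "cycles_from l s (v # vs) \<longleftrightarrow>
     v \<in> cycle_words \<and> segment l s (length v) = v \<and> cycles_from l (s + int (length v)) vs"

definition word :: "(int \<Rightarrow> nat) \<Rightarrow> (int \<Rightarrow> int) \<Rightarrow> int \<Rightarrow> nat list" where
  "word l T j = segment l (T j) (nat (T (j + 1) - T j))"

lemma length_segment [simp]: "length (segment l s n) = n"
  by (simp add: segment_def)

lemma nth_segment [simp]: "i < n \<Longrightarrow> segment l s n ! i = l (s + int i)"
  by (simp add: segment_def)

lemma segment_0 [simp]: "segment l s 0 = []"
  by (simp add: segment_def)

lemma segment_add: "segment l s (m + n) = segment l s m @ segment l (s + int m) n"
  by (rule nth_equalityI) (auto simp: nth_append)

text \<open>From a regeneration time on, no memory reaches back past that time, hence none past the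
  earlier \<open>s + int i\<close>. Only the values in between remain to be tested.\<close>

lemma regen_before_iff:
  assumes "regen l (s + int n)" "i \<le> n"
  shows "regen l (s + int i) \<longleftrightarrow> (\<forall>k. i \<le> k \<and> k < n \<longrightarrow> l (s + int k) \<le> k - i)"
proof
  assume r: "regen l (s + int i)"
  show "\<forall>k. i \<le> k \<and> k < n \<longrightarrow> l (s + int k) \<le> k - i"
  proof (intro allI impI)
    fix k assume k: "i \<le> k \<and> k < n"
    then have "l (s + int i + int (k - i)) \<le> k - i" using r unfolding regen_def by blast
    then show "l (s + int k) \<le> k - i" using k by (simp add: of_nat_diff)
  qed
next
  assume r: "\<forall>k. i \<le> k \<and> k < n \<longrightarrow> l (s + int k) \<le> k - i"
  show "regen l (s + int i)"
    unfolding regen_def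
  proof
    fix m
    show "l (s + int i + int m) \<le> m"
    proof (cases "i + m < n")
      case True
      then show ?thesis using r[rule_format, of "i + m"] by (simp add: add.assoc)
    next
      case False
      then have "l (s + int n + int (i + m - n)) \<le> i + m - n"
        using assms(1) unfolding regen_def by blast
      moreover have "s + int n + int (i + m - n) = s + int i + int m" using False by simp
      ultimately have "l (s + int i + int m) \<le> i + m - n" by metis
      then show ?thesis using assms(2) by linarith
    qed
  qed
qed

text \<open>By \<open>regen_before_iff\<close>, the first inequality of \<open>cycle_words\<close>
  is regeneration at offset 0, and the second one is its failure at each offset strictly between 0
  and \<open>n\<close>.\<close>

lemma segment_in_cycle_words_iff:
  assumes e: "regen l (s + int n)" and n: "0 < n"
  shows "segment l s n \<in> cycle_words \<longleftrightarrow>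
    regen l s \<and> (\<forall>z. s < z \<and> z < s + int n \<longrightarrow> \<not> regen l z)"
proof -
  have 1: "regen l s \<longleftrightarrow> (\<forall>i<n. segment l s n ! i \<le> i)"
    using regen_before_iff[OF e, of 0] by simp
  have "(\<forall>z. s < z \<and> z < s + int n \<longrightarrow> \<not> regen l z) \<longleftrightarrow>
      (\<forall>i. 0 < i \<and> i < n \<longrightarrow> \<not> regen l (s + int i))"
  proof (intro iffI allI impI)
    fix z assume h: "\<forall>i. 0 < i \<and> i < n \<longrightarrow> \<not> regen l (s + int i)" and z: "s < z \<and> z < s + int n"
    then show "\<not> regen l z" using h[rule_format, of "nat (z - s)"] by (auto simp: nat_less_iff)
  qed auto
  also have "\<dots> \<longleftrightarrow> (\<forall>i. 0 < i \<and> i < n \<longrightarrow>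
      (\<exists>k. i \<le> k \<and> k < n \<and> k - i < segment l s n ! k))"
  proof (intro all_cong1 imp_cong refl)
    fix i assume "0 < i \<and> i < n"
    then have "\<not> regen l (s + int i) \<longleftrightarrow> (\<exists>k. i \<le> k \<and> k < n \<and> k - i < l (s + int k))"
      using regen_before_iff[OF e, of i] by (simp add: not_le conj_assoc)
    also have "\<dots> \<longleftrightarrow> (\<exists>k. i \<le> k \<and> k < n \<and> k - i < segment l s n ! k)"
      by (intro ex_cong1 conj_cong refl) simp
    finally show "\<not> regen l (s + int i) \<longleftrightarrow>
      (\<exists>k. i \<le> k \<and> k < n \<and> k - i < segment l s n ! k)" .
  qed
  finally show ?thesis
    using 1 n by (auto simp: cycle_words_def simp flip: length_greater_0_conv)
qed

lemma cycles_from_regen: "cycles_from l s vs \<Longrightarrow> regen l s"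
proof (induction vs arbitrary: s)
  case (Cons v vs)
  then have "regen l (s + int (length v))" "0 < length v" "segment l s (length v) \<in> cycle_words"
    by (auto simp: cycle_words_def)
  then show ?case using segment_in_cycle_words_iff by blast
qed simp

text \<open>Turns consecutive cycles into one prescribed stretch of values followed by a
  regeneration time, the form in which the probability is computed.\<close>

lemma cycles_from_iff:
  "cycles_from l s vs \<longleftrightarrow> set vs \<subseteq> cycle_words \<and>
     segment l s (length (concat vs)) = concat vs \<and> regen l (s + int (length (concat vs)))"
  by (induction vs arbitrary: s) (auto simp: segment_add add.assoc)

lemma cycles_from_append:
  "cycles_from l s (us @ vs) \<longleftrightarrow>
     cycles_from l s us \<and> cycles_from l (s + int (length (concat us))) vs"
  by (induction us arbitrary: s) (auto simp: add.assoc dest: cycles_from_regen)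

section \<open>Indexed cycles versus words placed on the time axis\<close>

context
  fixes l T assumes T: "enumerates l T"
begin

lemma enumerates_strict: "T j < T (j + 1)" and enumerates_regen: "regen l (T j)"
  and enumerates_gap: "T j < z \<Longrightarrow> z < T (j + 1) \<Longrightarrow> \<not> regen l z"
  and enumerates_zero: "T 0 \<le> 0" "0 < T 1"
  using T by (auto simp: enumerates_def)

lemma length_word: "int (length (word l T j)) = T (j + 1) - T j"
  using enumerates_strict[of j] by (simp add: word_def)

lemma word_in_cycle_words: "word l T j \<in> cycle_words"
  unfolding word_def using enumerates_strict[of j] enumerates_regen enumerates_gap
  by (subst segment_in_cycle_words_iff) auto

text \<open>Both ends of \<open>v\<close> are regeneration times with none in between, and
  \<open>T\<close> skips no regeneration time, so either end determines the other. The direction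
  from right to left serves the cycles before the origin.\<close>

lemma cycle_succ_iff:
  assumes "cycles_from l s (v # vs)"
  shows "T j = s \<longleftrightarrow> T (j + 1) = s + int (length v)"
proof -
  let ?e = "s + int (length v)"
  have r: "regen l ?e" "regen l s" "0 < length v" and gap: "\<And>z. s < z \<Longrightarrow> z < ?e \<Longrightarrow> \<not> regen l z"
    using assms cycles_from_regen segment_in_cycle_words_iff[of l s "length v"]
    by (auto simp: cycle_words_def)
  show ?thesis
  proof
    assume j: "T j = s"
    then have "\<not> T (j + 1) < ?e" "\<not> ?e < T (j + 1)"
      using gap[of "T (j + 1)"] enumerates_regen enumerates_strict[of j]
        enumerates_gap[of j ?e] r by auto
    then show "T (j + 1) = ?e" by simp
  next
    assume j: "T (j + 1) = ?e"
    then have "\<not> T j < s" "\<not> s < T j"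
      using gap[of "T j"] enumerates_regen enumerates_strict[of j]
        enumerates_gap[of j s] r by auto
    then show "T j = s" by simp
  qed
qed

lemma cycles_end_iff:
  "cycles_from l s vs \<Longrightarrow> T j = s \<longleftrightarrow> T (j + int (length vs)) = s + int (length (concat vs))"
proof (induction vs arbitrary: s j)
  case (Cons v vs)
  then show ?case
    using cycle_succ_iff[of s v vs j] Cons.IH[of "s + int (length v)" "j + 1"]
    by (simp add: ac_simps)
qed simp

lemma words_iff_cycles_from:
  "(\<forall>k<length vs. word l T (j + int k) = vs ! k) \<longleftrightarrow> cycles_from l (T j) vs"
proof (induction vs arbitrary: j)
  case Nil
  then show ?case by (simp add: enumerates_regen)
next
  case (Cons v vs)
  have "(\<forall>k<length (v # vs). word l T (j + int k) = (v # vs) ! k) \<longleftrightarrow>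
      word l T j = v \<and> (\<forall>k<length vs. word l T (j + 1 + int k) = vs ! k)"
    by (auto simp: less_Suc_eq_0_disj add.assoc)
  also have "\<dots> \<longleftrightarrow> word l T j = v \<and> cycles_from l (T (j + 1)) vs"
    by (simp only: Cons.IH)
  also have "\<dots> \<longleftrightarrow> cycles_from l (T j) (v # vs)"
  proof
    assume h: "word l T j = v \<and> cycles_from l (T (j + 1)) vs"
    then have "int (length v) = T (j + 1) - T j" using length_word by blast
    then show "cycles_from l (T j) (v # vs)"
      using h word_in_cycle_words[of j] by (auto simp: word_def)
  next
    assume h: "cycles_from l (T j) (v # vs)"
    then have "T (j + 1) = T j + int (length v)" using cycle_succ_iff by blast
    then show "word l T j = v \<and> cycles_from l (T (j + 1)) vs" using h by (simp add: word_def)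
  qed
  finally show ?case .
qed

text \<open>Here \<open>t\<close> is the value of \<open>T 0\<close>, the start of the cycle
  straddling the origin, and \<open>m\<close> is the total length of the words before it. There are
  \<open>length v\<close> admissible starts, which is the source of the size bias.\<close>

lemma words_around_zero_iff:
  fixes us vs v defines "m \<equiv> int (length (concat us))"
  shows "(\<forall>k<length (us @ v # vs). word l T (int k - int (length us)) = (us @ v # vs) ! k) \<longleftrightarrow>
     (\<exists>t\<in>{- int (length v)<..0}. cycles_from l (t - m) (us @ v # vs))"
    (is "?L \<longleftrightarrow> ?R")
proof -
  let ?n = "int (length us)"
  have *: "?L \<longleftrightarrow> cycles_from l (T (- ?n)) (us @ v # vs)"
    using words_iff_cycles_from[of "us @ v # vs" "- ?n"] by (simp add: add.commute)
  show ?thesis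
  proof
    assume ?L
    then have c: "cycles_from l (T (- ?n)) (us @ v # vs)" using * by simp
    then have 0: "T 0 = T (- ?n) + m"
      using cycles_end_iff[of "T (- ?n)" us "- ?n"] by (auto simp: cycles_from_append m_def)
    then have "T 1 = T 0 + int (length v)"
      using c cycle_succ_iff[of "T 0" v vs 0] by (auto simp: cycles_from_append m_def)
    then show ?R using c 0 enumerates_zero by (intro bexI[of _ "T 0"]) auto
  next
    assume ?R
    then obtain t where t: "- int (length v) < t" "t \<le> 0"
      and c: "cycles_from l (t - m) (us @ v # vs)" by auto
    have c': "cycles_from l (t - m) us" "cycles_from l t (v # vs)"
      using c by (auto simp: cycles_from_append m_def)
    let ?e = "t + int (length v)"
    have r: "regen l ?e" "regen l t" and gap: "\<And>z. t < z \<Longrightarrow> z < ?e \<Longrightarrow> \<not> regen l z"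
      using c'(2) cycles_from_regen segment_in_cycle_words_iff[of l t "length v"]
      by (auto simp: cycle_words_def)
    \<comment> \<open>If \<open>T 0 < t\<close>, then \<open>t <= 0 < T 1\<close> puts a
      regeneration time into a gap of \<open>T\<close>; if \<open>t < T 0\<close>, then
      \<open>T 0 <= 0 < ?e\<close> puts one strictly inside \<open>v\<close>.\<close>
    have "\<not> T 0 < t" "\<not> t < T 0"
      using enumerates_gap[of 0 t] enumerates_zero t r gap[of "T 0"] enumerates_regen by auto
    then have "T 0 = t" by simp
    then have "T (- ?n) = t - m" using cycles_end_iff[OF c'(1), of "- ?n"] by (simp add: m_def)
    then show ?L using * c by simp
  qed
qed

end

section \<open>Finiteness of the regeneration times of a recurrent sequence\<close>

lemma int_set_max_exists:
  fixes P :: "int \<Rightarrow> bool"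
  assumes "P z" "\<And>y. P y \<Longrightarrow> y \<le> b"
  obtains y where "P y" "\<And>x. P x \<Longrightarrow> x \<le> y"
proof -
  \<comment> \<open>The distance below the bound \<open>b\<close> is a natural number, so the
    maximum can be found by minimising it.\<close>
  define m where "m = (LEAST m. P (b - int m))"
  have "P (b - int (nat (b - z)))" using assms by simp
  then have 1: "P (b - int m)" unfolding m_def by (rule LeastI)
  have "x \<le> b - int m" if "P x" for x
  proof -
    have "P (b - int (nat (b - x)))" using that assms by simp
    then have "m \<le> nat (b - x)" unfolding m_def by (rule Least_le)
    then show ?thesis using assms(2)[OF that] by linarith
  qed
  with 1 show thesis by (rule that)
qed

lemma int_set_min_exists:
  fixes P :: "int \<Rightarrow> bool"
  assumes "P z" "\<And>y. P y \<Longrightarrow> b \<le> y"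
  obtains y where "P y" "\<And>x. P x \<Longrightarrow> y \<le> x"
proof -
  obtain y where y: "P (- y)" "\<And>x. P (- x) \<Longrightarrow> x \<le> y"
  proof (rule int_set_max_exists[of "\<lambda>x. P (- x)" "- z" "- b"])
    show "P (- (- z))" using assms(1) by simp
    show "x \<le> - b" if "P (- x)" for x using assms(2)[OF that] by simp
  qed blast
  have "- y \<le> x" if "P x" for x using y(2)[of "- x"] that by simp
  with y(1) show thesis by (rule that)
qed

lemma Sup_ereal_int:
  assumes "P y" "\<And>x. P x \<Longrightarrow> x \<le> y"
  shows "Sup {ereal (of_int z) | z. P z} = ereal (of_int y)"
  using assms by (intro antisym Sup_least Sup_upper) auto

lemma Inf_ereal_int:
  assumes "P y" "\<And>x. P x \<Longrightarrow> y \<le> x"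
  shows "Inf {ereal (of_int z) | z. P z} = ereal (of_int y)"
  using assms by (intro antisym Inf_greatest Inf_lower) auto

context
  fixes l assumes l: "recurrent l"
begin

text \<open>Recurrence to the left makes each defining set nonempty; being bounded above, it attains
  its supremum at a regeneration time.\<close>

lemma regen_back_finite:
  "\<exists>z. regen_back l n = ereal (of_int z) \<and> regen l z \<and> z \<le> 0"
proof (induction n)
  case 0
  obtain z where "z \<le> 0" "regen l z" using l by (auto simp: recurrent_def)
  then obtain y where "y \<le> 0 \<and> regen l y" "\<And>x. x \<le> 0 \<and> regen l x \<Longrightarrow> x \<le> y"
    using int_set_max_exists[of "\<lambda>y. y \<le> 0 \<and> regen l y" z 0] by auto
  then show ?case using Sup_ereal_int[of "\<lambda>y. y \<le> 0 \<and> regen l y" y] by auto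
next
  case (Suc n)
  then obtain b where b: "regen_back l n = ereal (of_int b)" "b \<le> 0" by auto
  obtain z where "z \<le> b - 1" "regen l z" using l unfolding recurrent_def by blast
  then obtain y where "y < b \<and> regen l y" "\<And>x. x < b \<and> regen l x \<Longrightarrow> x \<le> y"
    using int_set_max_exists[of "\<lambda>y. y < b \<and> regen l y" z b] by auto
  then show ?case using Sup_ereal_int[of "\<lambda>y. y < b \<and> regen l y" y] b by auto
qed

lemma regen_forw_finite: "\<exists>z. regen_forw l n = ereal (of_int z) \<and> regen l z"
proof (induction n)
  case 0
  then show ?case using regen_back_finite[of 0] by auto
next
  case (Suc n)
  then obtain b where b: "regen_forw l n = ereal (of_int b)" by auto
  obtain z where "z \<ge> b + 1" "regen l z" using l unfolding recurrent_def by blast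
  then obtain y where "y > b \<and> regen l y" "\<And>x. x > b \<and> regen l x \<Longrightarrow> y \<le> x"
    using int_set_min_exists[of "\<lambda>y. y > b \<and> regen l y" z b] by auto
  then show ?case
    using Inf_ereal_int[of "\<lambda>x. x > b \<and> regen l x" y] b by auto
qed

text \<open>Along a recurrent sequence the floor and the conversion to reals in
  \<open>regen_time_int\<close> lose nothing.\<close>

lemma regen_time_eq: "regen_time l j = ereal (of_int (regen_time_int l j))"
  and regen_regen_time: "regen l (regen_time_int l j)"
proof -
  have "\<exists>z. regen_time l j = ereal (of_int z) \<and> regen l z"
    using regen_back_finite regen_forw_finite by (auto simp: regen_time_def)
  then show "regen_time l j = ereal (of_int (regen_time_int l j))" "regen l (regen_time_int l j)"
    by (auto simp: regen_time_int_def)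
qed

lemma regen_time_step:
  "regen_time_int l j < regen_time_int l (j + 1) \<and>
   (\<forall>z. regen_time_int l j < z \<and> z < regen_time_int l (j + 1) \<longrightarrow> \<not> regen l z)"
proof (cases "j < 0")
  \<comment> \<open>To the left of the origin, the time with index \<open>j\<close> is defined from
    the one with index \<open>j + 1\<close>; in the other case the recursion runs the opposite
    way.\<close>
  case True
  define n where "n = nat (- j - 1)"
  have n: "nat (- j) = Suc n" "nat (- (j + 1)) = n" using True by (auto simp: n_def)
  let ?P = "\<lambda>z. z < regen_time_int l (j + 1) \<and> regen l z"
  have eq: "regen_time l j = Sup {ereal (of_int z) | z. ?P z}"
    using True n regen_time_eq[of "j + 1"] by (simp add: regen_time_def)
  obtain z where "?P z"
    using l unfolding recurrent_def by (metis zle_diff1_eq)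
  then obtain y where y: "?P y" "\<And>x. ?P x \<Longrightarrow> x \<le> y"
    using int_set_max_exists[of ?P z "regen_time_int l (j + 1)"] by auto
  then have "regen_time_int l j = y"
    using eq Sup_ereal_int[of ?P y] by (simp add: regen_time_int_def)
  then show ?thesis using y by force
next
  case False
  define n where "n = nat j"
  have n: "nat (j + 1) = Suc n" using False by (auto simp: n_def)
  let ?P = "\<lambda>z. z > regen_time_int l j \<and> regen l z"
  \<comment> \<open>At \<open>j = 0\<close> the value comes from \<open>regen_back\<close>, which is
    also the starting value of \<open>regen_forw\<close>.\<close>
  have "regen_time l j = regen_forw l n"
    using False by (auto simp: regen_time_def n_def)
  then have eq: "regen_time l (j + 1) = Inf {ereal (of_int z) | z. ?P z}"
    using False n regen_time_eq[of j] by (simp add: regen_time_def)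
  obtain z where "?P z"
    using l unfolding recurrent_def by (metis add1_zle_eq)
  then obtain y where y: "?P y" "\<And>x. ?P x \<Longrightarrow> y \<le> x"
    using int_set_min_exists[of ?P z "regen_time_int l j"] by auto
  then have "regen_time_int l (j + 1) = y"
    using eq Inf_ereal_int[of ?P y] by (simp add: regen_time_int_def)
  then show ?thesis using y by force
qed

lemma enumerates_regen_time: "enumerates l (regen_time_int l)"
proof -
  have "regen_time l 0 \<le> 0"
    by (auto simp: regen_time_def intro!: Sup_least)
  then have 0: "regen_time_int l 0 \<le> 0" using regen_time_eq[of 0] by simp
  \<comment> \<open>Otherwise the time with index 1 would belong to the set whose supremum is the
    time with index 0, against strict monotonicity.\<close>
  have "\<not> regen_time_int l 1 \<le> 0"
  proof
    assume "regen_time_int l 1 \<le> 0"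
    then have "regen_time l 1 \<le> regen_time l 0"
      using regen_regen_time[of 1] regen_time_eq[of 1]
      by (auto simp: regen_time_def[of _ 0] intro!: Sup_upper)
    then show False using regen_time_step[of 0] regen_time_eq by simp
  qed
  with 0 show ?thesis using regen_time_step regen_regen_time by (auto simp: enumerates_def)
qed

end

subsection \<open>Discrete random variables and the law of the cycles\<close>

lemma measurable_map_countable:
  fixes X :: "'i \<Rightarrow> 'a \<Rightarrow> 'b::countable"
  assumes "\<And>i. X i \<in> measurable M (count_space UNIV)"
  shows "(\<lambda>\<omega>. map (\<lambda>i. X i \<omega>) xs) \<in> measurable M (count_space UNIV)"
proof (induction xs)
  case (Cons x xs)
  have "(\<lambda>\<omega>. (\<lambda>(a, ys). a # ys) (X x \<omega>, map (\<lambda>i. X i \<omega>) xs)) \<in> measurable M (count_space UNIV)"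
    by (intro measurable_compose_countable[OF _ assms[of x], of "\<lambda>a \<omega>. (\<lambda>(a, ys). a # ys) (a, map (\<lambda>i. X i \<omega>) xs)"]
      measurable_compose_countable[OF _ Cons.IH, of "\<lambda>ys \<omega>. (\<lambda>(a, ys). a # ys) (_, ys)"]) simp
  then show ?case by simp
qed simp

context prob_space
begin

text \<open>The fibres of single points generate the sigma-algebras, as every preimage is a
  countable union of them, and independence extends from an intersection-stable generator.\<close>

lemma indep_vars_countableI:
  fixes X :: "'i \<Rightarrow> 'a \<Rightarrow> 'b::countable"
  assumes rv: "\<And>i. X i \<in> measurable M (count_space UNIV)"
    and joint: "\<And>J v. finite J \<Longrightarrow> prob {\<omega> \<in> space M. \<forall>j\<in>J. X j \<omega> = v j} =
      (\<Prod>j\<in>J. prob {\<omega> \<in> space M. X j \<omega> = v j})"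
  shows "indep_vars (\<lambda>_. count_space UNIV) X UNIV"
proof -
  \<comment> \<open>The empty set is included because distinct fibres are disjoint, which makes
    \<open>E i\<close> stable under intersection.\<close>
  define E where "E i = insert {} (range (\<lambda>x. X i -` {x} \<inter> space M))" for i
  have ev: "X i -` A \<inter> space M \<in> events" for i A
    using measurable_sets[OF rv] by auto
  have "indep_sets E UNIV"
  proof (rule indep_setsI)
    show "E i \<subseteq> events" for i using ev by (auto simp: E_def)
    fix A J assume J: "J \<noteq> {}" "finite (J :: 'i set)" and A: "\<forall>j\<in>J. A j \<in> E j"
    show "prob (\<Inter>j\<in>J. A j) = (\<Prod>j\<in>J. prob (A j))"
    proof (cases "\<exists>j\<in>J. A j = {}")
      case True
      then have "(\<Inter>j\<in>J. A j) = {}" "(\<Prod>j\<in>J. prob (A j)) = 0"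
        using J by (auto intro!: prod_zero bexI)
      then show ?thesis by simp
    next
      case False
      then have "\<forall>j\<in>J. \<exists>x. A j = X j -` {x} \<inter> space M" using A unfolding E_def by blast
      then obtain v where v: "\<And>j. j \<in> J \<Longrightarrow> A j = {\<omega> \<in> space M. X j \<omega> = v j}"
        by (subst (asm) bchoice_iff) (auto simp: vimage_def Int_def conj_commute)
      then have "(\<Inter>j\<in>J. A j) = {\<omega> \<in> space M. \<forall>j\<in>J. X j \<omega> = v j}" using J by auto
      then show ?thesis using joint[OF J(2), of v] v by (simp cong: prod.cong)
    qed
  qed
  moreover have "Int_stable (E i)" for i
  proof (rule Int_stableI)
    fix a b assume "a \<in> E i" "b \<in> E i"
    then consider "a = {}" | "b = {}" |
      x y where "a = X i -` {x} \<inter> space M" "b = X i -` {y} \<inter> space M"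
      unfolding E_def by blast
    then show "a \<inter> b \<in> E i"
    proof cases
      case (3 x y)
      then have "x = y \<Longrightarrow> a \<inter> b = X i -` {x} \<inter> space M" "x \<noteq> y \<Longrightarrow> a \<inter> b = {}" by auto
      then show ?thesis by (cases "x = y") (auto simp: E_def)
    qed (auto simp: E_def)
  qed
  ultimately have indep: "indep_sets (\<lambda>i. sigma_sets (space M) (E i)) UNIV"
    by (intro indep_sets_sigma)
  have sub: "X i -` A \<inter> space M \<in> sigma_sets (space M) (E i)" for i A
  proof -
    have "(\<Union>x\<in>A. X i -` {x} \<inter> space M) \<in> sigma_sets (space M) (E i)"
    proof (rule sigma_sets_UNION)
      fix B assume "B \<in> (\<lambda>x. X i -` {x} \<inter> space M) ` A"
      then have "B \<in> E i" unfolding E_def by blast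
      then show "B \<in> sigma_sets (space M) (E i)" by (rule sigma_sets.Basic)
    qed (intro countable_image countableI_type)
    also have "(\<Union>x\<in>A. X i -` {x} \<inter> space M) = X i -` A \<inter> space M" by auto
    finally show ?thesis .
  qed
  show ?thesis
    unfolding indep_vars_def2
  proof (intro conjI ballI rv)
    show "indep_sets (\<lambda>i. {X i -` A \<inter> space M |A. A \<in> sets (count_space UNIV)}) UNIV"
      by (rule indep_sets_mono_sets[OF indep]) (use sub in blast)
  qed
qed

lemma nn_integral_emeasure_slices:
  fixes X :: "'a \<Rightarrow> 'b::countable"
  assumes "X \<in> measurable M (count_space UNIV)" "{\<omega> \<in> space M. P \<omega>} \<in> events"
  shows "(\<integral>\<^sup>+x. emeasure M {\<omega> \<in> space M. P \<omega> \<and> X \<omega> = x} \<partial>count_space UNIV) =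
    emeasure M {\<omega> \<in> space M. P \<omega>}"
proof -
  have ev: "{\<omega> \<in> space M. P \<omega> \<and> X \<omega> = x} \<in> events" for x
  proof -
    have "{\<omega> \<in> space M. P \<omega>} \<inter> (X -` {x} \<inter> space M) \<in> events"
      using assms measurable_sets[OF assms(1), of "{x}"] by auto
    also have "{\<omega> \<in> space M. P \<omega>} \<inter> (X -` {x} \<inter> space M) = {\<omega> \<in> space M. P \<omega> \<and> X \<omega> = x}"
      by auto
    finally show ?thesis .
  qed
  have "emeasure M (\<Union>x. {\<omega> \<in> space M. P \<omega> \<and> X \<omega> = x}) =
      (\<integral>\<^sup>+x. emeasure M {\<omega> \<in> space M. P \<omega> \<and> X \<omega> = x} \<partial>count_space UNIV)"
    using ev by (intro emeasure_UN_countable) (auto simp: disjoint_family_on_def)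
  also have "(\<Union>x. {\<omega> \<in> space M. P \<omega> \<and> X \<omega> = x}) = {\<omega> \<in> space M. P \<omega>}" by auto
  finally show ?thesis by simp
qed

text \<open>For the cycles, the joint law is available on symmetric windows of indices. A product
  formula on a superset of \<open>J\<close> passes to \<open>J\<close> by summing out the other
  indices, each factor having total mass 1.\<close>

lemma
  fixes X :: "'i \<Rightarrow> 'a \<Rightarrow> 'b::countable" and q :: "'i \<Rightarrow> 'b \<Rightarrow> real"
  assumes rv: "\<And>i. X i \<in> measurable M (count_space UNIV)"
    and q_nonneg: "\<And>i x. 0 \<le> q i x"
    and q_mass: "\<And>i. (\<integral>\<^sup>+x. ennreal (q i x) \<partial>count_space UNIV) = 1"
    and joint: "\<And>J. finite J \<Longrightarrow> \<exists>I. finite I \<and> J \<subseteq> I \<and>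
      (\<forall>v. prob {\<omega> \<in> space M. \<forall>i\<in>I. X i \<omega> = v i} = (\<Prod>i\<in>I. q i (v i)))"
  shows prob_eq_mass: "prob {\<omega> \<in> space M. X i \<omega> = x} = q i x"
    and indep_vars_of_mass: "indep_vars (\<lambda>_. count_space UNIV) X UNIV"
proof -
  have ev: "{\<omega> \<in> space M. \<forall>i\<in>J. X i \<omega> = v i} \<in> events" if "finite J" for J v
    using that rv by measurable
  \<comment> \<open>Induction on the surplus indices \<open>D\<close> with \<open>J\<close>
    arbitrary: the induction hypothesis is used for \<open>insert d J\<close>, and then the value of
    \<open>X d\<close> is summed out.\<close>
  have drop: "prob {\<omega> \<in> space M. \<forall>i\<in>J. X i \<omega> = v i} = (\<Prod>i\<in>J. q i (v i))"
    if "finite D" "finite J" "D \<inter> J = {}"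
      "\<And>v. prob {\<omega> \<in> space M. \<forall>i\<in>J \<union> D. X i \<omega> = v i} = (\<Prod>i\<in>J \<union> D. q i (v i))" for J D v
    using that
  proof (induction D arbitrary: J v rule: finite_induct)
    case (insert d D)
    have *: "prob {\<omega> \<in> space M. \<forall>i\<in>insert d J. X i \<omega> = v i} = (\<Prod>i\<in>insert d J. q i (v i))" for v
    proof (rule insert.IH)
      show "D \<inter> insert d J = {}" "finite (insert d J)" using insert.prems insert.hyps by auto
      show "prob {\<omega> \<in> space M. \<forall>i\<in>insert d J \<union> D. X i \<omega> = v i} = (\<Prod>i\<in>insert d J \<union> D. q i (v i))" for v
        using insert.prems(3)[of v] by simp
    qed
    have d: "finite J" "d \<notin> J" using insert.prems by auto
    have "emeasure M {\<omega> \<in> space M. \<forall>i\<in>J. X i \<omega> = v i} =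
        (\<integral>\<^sup>+x. emeasure M {\<omega> \<in> space M. (\<forall>i\<in>J. X i \<omega> = v i) \<and> X d \<omega> = x} \<partial>count_space UNIV)"
      using ev d rv by (intro nn_integral_emeasure_slices[symmetric]) auto
    also have "\<dots> = (\<integral>\<^sup>+x. ennreal (\<Prod>i\<in>J. q i (v i)) * ennreal (q d x) \<partial>count_space UNIV)"
    proof (intro nn_integral_cong)
      fix x
      have "{\<omega> \<in> space M. (\<forall>i\<in>J. X i \<omega> = v i) \<and> X d \<omega> = x} =
          {\<omega> \<in> space M. \<forall>i\<in>insert d J. X i \<omega> = (v(d := x)) i}"
        using d by auto
      moreover have "(\<Prod>i\<in>insert d J. q i ((v(d := x)) i)) = q d x * (\<Prod>i\<in>J. q i (v i))"
        using d by (auto intro!: prod.cong)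
      ultimately show "emeasure M {\<omega> \<in> space M. (\<forall>i\<in>J. X i \<omega> = v i) \<and> X d \<omega> = x} =
          ennreal (\<Prod>i\<in>J. q i (v i)) * ennreal (q d x)"
        using *[of "v(d := x)"]
        by (simp only: emeasure_eq_measure ennreal_mult' q_nonneg prod_nonneg mult.commute)
    qed
    also have "\<dots> = ennreal (\<Prod>i\<in>J. q i (v i))"
      by (subst nn_integral_cmult) (auto simp: q_mass)
    finally show ?case
      by (simp add: emeasure_eq_measure prod_nonneg q_nonneg)
  qed simp
  have fin: "prob {\<omega> \<in> space M. \<forall>i\<in>J. X i \<omega> = v i} = (\<Prod>i\<in>J. q i (v i))" if J: "finite J" for J v
  proof -
    obtain I where I: "finite I" "J \<subseteq> I"
      "\<And>v. prob {\<omega> \<in> space M. \<forall>i\<in>I. X i \<omega> = v i} = (\<Prod>i\<in>I. q i (v i))"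
      using joint[OF J] by blast
    have J_I: "J \<union> (I - J) = I" using I by auto
    show ?thesis
    proof (rule drop[of "I - J"])
      show "prob {\<omega> \<in> space M. \<forall>i\<in>J \<union> (I - J). X i \<omega> = v i} = (\<Prod>i\<in>J \<union> (I - J). q i (v i))" for v
        unfolding J_I by (rule I)
    qed (use I J in blast)+
  qed
  show single: "prob {\<omega> \<in> space M. X i \<omega> = x} = q i x" for i x
  proof -
    have "prob {\<omega> \<in> space M. \<forall>j\<in>{i}. X j \<omega> = x} = (\<Prod>j\<in>{i}. q j x)"
      by (rule fin) simp
    then show ?thesis by simp
  qed
  show "indep_vars (\<lambda>_. count_space UNIV) X UNIV"
  proof (rule indep_vars_countableI)
    fix J v assume J: "finite (J :: 'i set)"
    show "prob {\<omega> \<in> space M. \<forall>j\<in>J. X j \<omega> = v j} = (\<Prod>j\<in>J. prob {\<omega> \<in> space M. X j \<omega> = v j})"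
      unfolding fin[OF J] single ..
  qed (rule rv)
qed

end

section \<open>Probability of prescribed consecutive cycles for iid memories\<close>

locale iid_memories = prob_space M for M :: "'c measure" +
  fixes L :: "int \<Rightarrow> 'c \<Rightarrow> nat" and p :: "nat \<Rightarrow> real"
  assumes L_indep: "indep_vars (\<lambda>_. count_space UNIV) L UNIV"
    and L_law: "prob {\<omega> \<in> space M. L n \<omega> = k} = p k"
    and convergent_prod: "convergent_prod (\<lambda>m. \<Sum>k\<le>m. p k)"
    and prodinf_pos: "0 < prodinf (\<lambda>m. \<Sum>k\<le>m. p k)"
begin

text \<open>The constant \<open>c\<close> of the overview: the factor with index \<open>m\<close> is
  the probability that the memory at distance \<open>m\<close> after a given time does not reach
  past it.\<close>

definition regen_prob :: real where
  "regen_prob = prodinf (\<lambda>m. \<Sum>k\<le>m. p k)"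

text \<open>The path as one random sequence, to which the deterministic lemmas apply; it generates
  the sigma-algebra on which \<open>generated_blocks\<close> conditions.\<close>

definition memory :: "'c \<Rightarrow> int \<Rightarrow> nat" where
  "memory \<omega> = (\<lambda>n. L n \<omega>)"

lemma p_nonneg: "0 \<le> p k"
  using L_law[of 0 k] measure_nonneg by metis

lemma L_measurable [measurable]: "L n \<in> measurable M (count_space UNIV)"
  using L_indep by (simp add: indep_vars_def)

lemma memory_measurable: "memory \<in> measurable M (PiM UNIV (\<lambda>_. count_space UNIV))"
  unfolding memory_def by (rule measurable_PiM_single') auto

lemma pred_regen [measurable]: "Measurable.pred M (\<lambda>\<omega>. regen (memory \<omega>) z)"
  unfolding regen_def memory_def by measurable

lemma pred_segment [measurable]: "Measurable.pred M (\<lambda>\<omega>. segment (memory \<omega>) s n = v)"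
proof -
  have "(\<lambda>\<omega>. segment (memory \<omega>) s n = v) =
      (\<lambda>\<omega>. length v = n \<and> (\<forall>i\<in>{..<n}. L (s + int i) \<omega> = v ! i))"
    by (auto simp: list_eq_iff_nth_eq memory_def)
  also have "Measurable.pred M \<dots>" by measurable
  finally show ?thesis .
qed

lemma pred_cycles_from [measurable]: "Measurable.pred M (\<lambda>\<omega>. cycles_from (memory \<omega>) s vs)"
  unfolding cycles_from_iff by measurable

lemma prob_L_in: "finite A \<Longrightarrow> prob {\<omega> \<in> space M. L n \<omega> \<in> A} = (\<Sum>k\<in>A. p k)"
proof -
  assume A: "finite A"
  have "prob (\<Union>k\<in>A. {\<omega> \<in> space M. L n \<omega> = k}) = (\<Sum>k\<in>A. prob {\<omega> \<in> space M. L n \<omega> = k})"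
    using A by (intro finite_measure_finite_Union) (auto simp: disjoint_family_on_def)
  also have "(\<Union>k\<in>A. {\<omega> \<in> space M. L n \<omega> = k}) = {\<omega> \<in> space M. L n \<omega> \<in> A}" by auto
  finally show ?thesis by (simp add: L_law)
qed

lemma prob_L_joint:
  assumes J: "finite J" and f: "inj_on f J" and A: "\<And>j. j \<in> J \<Longrightarrow> finite (A j)"
  shows "prob {\<omega> \<in> space M. \<forall>j\<in>J. L (f j) \<omega> \<in> A j} = (\<Prod>j\<in>J. \<Sum>k\<in>A j. p k)"
proof (cases "J = {}")
  case True
  then show ?thesis by (simp add: prob_space)
next
  case False
  let ?g = "the_inv_into J f"
  have g: "?g (f j) = j" if "j \<in> J" for j using f that by (rule the_inv_into_f_f)
  have "prob (\<Inter>n\<in>f ` J. L n -` A (?g n) \<inter> space M) =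
      (\<Prod>n\<in>f ` J. prob (L n -` A (?g n) \<inter> space M))"
    using False J by (intro indep_varsD[OF L_indep]) auto
  also have "\<dots> = (\<Prod>j\<in>J. prob (L (f j) -` A j \<inter> space M))"
    using f g by (simp add: prod.reindex)
  also have "\<dots> = (\<Prod>j\<in>J. \<Sum>k\<in>A j. p k)"
    using prob_L_in[OF A] by (intro prod.cong refl) (simp add: vimage_def Int_def conj_commute)
  also have "(\<Inter>n\<in>f ` J. L n -` A (?g n) \<inter> space M) = {\<omega> \<in> space M. \<forall>j\<in>J. L (f j) \<omega> \<in> A j}"
    using False g by auto
  finally show ?thesis .
qed

text \<open>Used for the embedding of the naturals, as the 0-1 law needs a family indexed by them,
  and for translations, to obtain stationarity.\<close>

lemma indep_vars_L_reindex:
  fixes f :: "'i \<Rightarrow> int"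
  assumes "inj f"
  shows "indep_vars (\<lambda>_. count_space UNIV) (\<lambda>i. L (f i)) UNIV"
proof (rule indep_vars_countableI)
  fix J :: "'i set" and v assume J: "finite J"
  show "prob {\<omega> \<in> space M. \<forall>j\<in>J. L (f j) \<omega> = v j} = (\<Prod>j\<in>J. prob {\<omega> \<in> space M. L (f j) \<omega> = v j})"
    using prob_L_joint[OF J inj_on_subset[OF assms], of "\<lambda>j. {v j}"] by (simp add: L_law)
qed simp

text \<open>The letters of \<open>v\<close> and the regeneration at its end constrain different
  coordinates of \<open>L\<close>, so the probabilities multiply. The infinitely many constraints
  are reached through finite truncations and continuity from above.\<close>

lemma prob_segment_regen:
  "prob {\<omega> \<in> space M. segment (memory \<omega>) s (length v) = v \<and> regen (memory \<omega>) (s + int (length v))} =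
     prod_list (map p v) * regen_prob"
proof -
  let ?n = "length v"
  \<comment> \<open>The set of values allowed at offset \<open>i\<close>: the prescribed letter
    inside \<open>v\<close>, and after it at most the distance from the end of
    \<open>v\<close>.\<close>
  define B where "B i = (if i < ?n then {v ! i} else {..i - ?n})" for i
  define E where "E N = {\<omega> \<in> space M. \<forall>i\<in>{..<?n + Suc N}. L (s + int i) \<omega> \<in> B i}" for N
  have "prob (E N) = prod_list (map p v) * (\<Prod>m\<le>N. \<Sum>k\<le>m. p k)" for N
  proof -
    have "prob (E N) = (\<Prod>i<?n + Suc N. \<Sum>k\<in>B i. p k)"
      unfolding E_def by (intro prob_L_joint) (auto simp: B_def inj_on_def)
    also have "\<dots> = (\<Prod>i=0..<?n. \<Sum>k\<in>B i. p k) * (\<Prod>i=?n..<?n + Suc N. \<Sum>k\<in>B i. p k)"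
      unfolding lessThan_atLeast0 by (rule prod.atLeastLessThan_concat[symmetric]) auto
    also have "(\<Prod>i=0..<?n. \<Sum>k\<in>B i. p k) = (\<Prod>i=0..<?n. p (v ! i))"
      by (intro prod.cong) (auto simp: B_def)
    also have "\<dots> = prod_list (map p v)"
      by (simp add: prod.list_conv_set_nth)
    also have "(\<Prod>i=?n..<?n + Suc N. \<Sum>k\<in>B i. p k) = (\<Prod>m\<le>N. \<Sum>k\<le>m. p k)"
      using prod.shift_bounds_nat_ivl[of "\<lambda>i. \<Sum>k\<in>B i. p k" 0 ?n "Suc N"]
      by (simp add: B_def add.commute atLeast0LessThan lessThan_Suc_atMost)
    finally show ?thesis .
  qed
  moreover have "(\<lambda>N. \<Prod>m\<le>N. \<Sum>k\<le>m. p k) \<longlonglongrightarrow> regen_prob"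
    unfolding regen_prob_def by (rule convergent_prod_LIMSEQ[OF convergent_prod])
  ultimately have 1: "(\<lambda>N. prob (E N)) \<longlonglongrightarrow> prod_list (map p v) * regen_prob"
    by (auto intro!: tendsto_intros)
  have 2: "(\<lambda>N. prob (E N)) \<longlonglongrightarrow> prob (\<Inter>N. E N)"
  proof (rule finite_Lim_measure_decseq)
    show "range E \<subseteq> events" unfolding E_def by auto
    show "decseq E" by (auto simp: decseq_def E_def)
  qed
  have "(\<Inter>N. E N) =
      {\<omega> \<in> space M. segment (memory \<omega>) s ?n = v \<and> regen (memory \<omega>) (s + int ?n)}" (is "_ = ?R")
  proof (intro set_eqI iffI)
    fix \<omega> assume w: "\<omega> \<in> (\<Inter>N. E N)"
    then have *: "L (s + int i) \<omega> \<in> B i" for i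
      by (auto simp: E_def dest!: spec[of _ i])
    have "L (s + int i) \<omega> = v ! i" if "i < ?n" for i
      using *[of i] that by (simp add: B_def)
    then have "segment (memory \<omega>) s ?n = v"
      by (intro nth_equalityI) (auto simp: memory_def)
    moreover have "regen (memory \<omega>) (s + int ?n)"
      unfolding regen_def
    proof
      fix m show "memory \<omega> (s + int ?n + int m) \<le> m"
        using *[of "?n + m"] by (simp add: B_def memory_def add.assoc)
    qed
    ultimately show "\<omega> \<in> ?R" using w by (auto simp: E_def)
  next
    fix \<omega> assume w: "\<omega> \<in> ?R"
    have "L (s + int i) \<omega> \<in> B i" for i
    proof (cases "i < ?n")
      case True
      then have "L (s + int i) \<omega> = segment (memory \<omega>) s ?n ! i" by (simp add: memory_def)
      also have "segment (memory \<omega>) s ?n = v" using w by simp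
      finally show ?thesis using True by (simp add: B_def)
    next
      case False
      then have "memory \<omega> (s + int ?n + int (i - ?n)) \<le> i - ?n" using w unfolding regen_def by blast
      then show ?thesis using False by (simp add: B_def memory_def of_nat_diff)
    qed
    then show "\<omega> \<in> (\<Inter>N. E N)" using w by (auto simp: E_def)
  qed
  then show ?thesis using LIMSEQ_unique[OF 1 2] by simp
qed

lemma prob_regen: "prob {\<omega> \<in> space M. regen (memory \<omega>) z} = regen_prob"
  using prob_segment_regen[of z "[]"] by simp

lemma regen_prob_pos: "0 < regen_prob"
  using prodinf_pos by (simp add: regen_prob_def)

lemma prob_cycles_from:
  "prob {\<omega> \<in> space M. cycles_from (memory \<omega>) s vs} =
     (if set vs \<subseteq> cycle_words then (\<Prod>v\<leftarrow>vs. prod_list (map p v)) * regen_prob else 0)"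
proof -
  have "prod_list (map p (concat vs)) = (\<Prod>v\<leftarrow>vs. prod_list (map p v))"
    by (induction vs) auto
  then show ?thesis
    unfolding cycles_from_iff using prob_segment_regen[of s "concat vs"] by simp
qed

end

subsection \<open>Almost sure recurrence\<close>

text \<open>The index set of the supremum no longer depends on \<open>P\<close>, so measurability of
  countable suprema applies; a rejected integer contributes the neutral value. The infimum is
  treated alike below.\<close>

lemma Sup_ereal_int_eq_SUP:
  "Sup {ereal (of_int z) | z. P z} = (SUP z. if P z then ereal (of_int z) else - \<infinity>)"
proof (rule antisym)
  show "Sup {ereal (of_int z) | z. P z} \<le> (SUP z. if P z then ereal (of_int z) else - \<infinity>)"
  proof (rule Sup_least, clarify)
    fix z assume "P z"
    then show "ereal (of_int z) \<le> (SUP z. if P z then ereal (of_int z) else - \<infinity>)"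
      by (intro SUP_upper2[of z]) auto
  qed
  show "(SUP z. if P z then ereal (of_int z) else - \<infinity>) \<le> Sup {ereal (of_int z) | z. P z}"
  proof (rule SUP_least)
    fix z show "(if P z then ereal (of_int z) else - \<infinity>) \<le> Sup {ereal (of_int z) | z. P z}"
      by (cases "P z") (auto intro: Sup_upper)
  qed
qed

lemma Inf_ereal_int_eq_INF:
  "Inf {ereal (of_int z) | z. P z} = (INF z. if P z then ereal (of_int z) else \<infinity>)"
proof (rule antisym)
  show "(INF z. if P z then ereal (of_int z) else \<infinity>) \<le> Inf {ereal (of_int z) | z. P z}"
  proof (rule Inf_greatest, clarify)
    fix z assume "P z"
    then show "(INF z. if P z then ereal (of_int z) else \<infinity>) \<le> ereal (of_int z)"
      by (intro INF_lower2[of z]) auto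
  qed
  show "Inf {ereal (of_int z) | z. P z} \<le> (INF z. if P z then ereal (of_int z) else \<infinity>)"
  proof (rule INF_greatest)
    fix z show "Inf {ereal (of_int z) | z. P z} \<le> (if P z then ereal (of_int z) else \<infinity>)"
      by (cases "P z") (auto intro: Inf_lower)
  qed
qed

lemma pred_regen_PiM [measurable]:
  "Measurable.pred (PiM UNIV (\<lambda>_. count_space UNIV)) (\<lambda>l. regen l z)"
  unfolding regen_def by measurable

lemma regen_back_measurable [measurable]:
  "(\<lambda>l. regen_back l n) \<in> borel_measurable (PiM UNIV (\<lambda>_. count_space UNIV))"
proof (induction n)
  case 0
  show ?case by (simp only: regen_back.simps Sup_ereal_int_eq_SUP) measurable
next
  case (Suc n)
  note [measurable] = Suc.IH
  show ?case by (simp only: regen_back.simps Sup_ereal_int_eq_SUP) measurable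
qed

lemma regen_forw_measurable [measurable]:
  "(\<lambda>l. regen_forw l n) \<in> borel_measurable (PiM UNIV (\<lambda>_. count_space UNIV))"
proof (induction n)
  case 0
  show ?case unfolding regen_forw.simps(1) by (rule regen_back_measurable)
next
  case (Suc n)
  note [measurable] = Suc.IH
  show ?case by (simp only: regen_forw.simps Inf_ereal_int_eq_INF) measurable
qed

lemma regen_time_int_measurable:
  "(\<lambda>l. regen_time_int l n) \<in> measurable (PiM UNIV (\<lambda>_. count_space UNIV)) (count_space UNIV)"
  unfolding regen_time_int_def regen_time_def by measurable

section \<open>Infinitely many regeneration times in both directions\<close>

context iid_memories
begin

lemma regen_time_int_memory_measurable [measurable]:
  "(\<lambda>\<omega>. regen_time_int (memory \<omega>) n) \<in> measurable M (count_space UNIV)"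
  by (rule measurable_compose[OF memory_measurable regen_time_int_measurable])

text \<open>The 0-1 law leaves probability 0 or 1. Continuity from above bounds the probability
  below by \<open>regen_prob\<close>, which is positive.\<close>

lemma AE_regen_after: "AE \<omega> in M. \<forall>n. \<exists>z\<ge>n. regen (memory \<omega>) z"
proof -
  define X where "X = {\<omega> \<in> space M. \<forall>n. \<exists>k. regen (memory \<omega>) (int (n + k))}"
  define A where "A i = {L (int i) -` B \<inter> space M | B. B \<in> sets (count_space UNIV)}" for i
  have A: "sigma_algebra (space M) (A i)" for i
    using sets.sigma_algebra_axioms[of "vimage_algebra (space M) (L (int i)) (count_space UNIV)"]
    by (simp add: A_def sets_vimage_algebra2)
  have indep: "indep_sets A UNIV"
    using indep_vars_L_reindex[of int] unfolding indep_vars_def2 A_def by simp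
  have "X \<in> tail_events A"
    unfolding tail_events_def
  proof
    fix j
    define N where "N = sigma (space M) (\<Union>(A ` {j..}))"
    have sub: "\<Union>(A ` {j..}) \<subseteq> Pow (space M)" by (auto simp: A_def)
    have space_N: "space N = space M" unfolding N_def by (rule space_measure_of) (rule sub)
    have [measurable]: "L (int (j + i)) \<in> measurable N (count_space UNIV)" for i
    proof (rule measurableI)
      fix B :: "nat set"
      have "L (int (j + i)) -` B \<inter> space M \<in> A (j + i)" by (auto simp: A_def)
      then have "L (int (j + i)) -` B \<inter> space M \<in> \<Union>(A ` {j..})" by auto
      then show "L (int (j + i)) -` B \<inter> space N \<in> sets N"
        unfolding space_N unfolding N_def by (simp add: sub sigma_sets.Basic)
    qed simp
    \<comment> \<open>Discarding the times before \<open>j\<close> does not change whether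
      regeneration recurs, and from \<open>j\<close> on it depends on the coordinates from
      \<open>j\<close> on.\<close>
    have "X = {\<omega> \<in> space N. \<forall>n. \<exists>k. \<forall>m. L (int (j + (n + k + m))) \<omega> \<le> m}"
    proof (intro set_eqI iffI)
      fix \<omega> assume X: "\<omega> \<in> X"
      have "\<exists>k. \<forall>m. L (int (j + (n + k + m))) \<omega> \<le> m" for n
      proof -
        obtain k where "regen (memory \<omega>) (int (j + n + k))" using X unfolding X_def by blast
        then have "\<forall>m. L (int (j + (n + k + m))) \<omega> \<le> m"
          by (simp add: regen_def memory_def ac_simps)
        then show ?thesis ..
      qed
      then show "\<omega> \<in> {\<omega> \<in> space N. \<forall>n. \<exists>k. \<forall>m. L (int (j + (n + k + m))) \<omega> \<le> m}"
        using X by (simp add: space_N X_def)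
    next
      fix \<omega> assume *: "\<omega> \<in> {\<omega> \<in> space N. \<forall>n. \<exists>k. \<forall>m. L (int (j + (n + k + m))) \<omega> \<le> m}"
      have "\<exists>k. regen (memory \<omega>) (int (n + k))" for n
      proof -
        obtain k where "\<forall>m. L (int (j + (n + k + m))) \<omega> \<le> m" using * by blast
        then have "regen (memory \<omega>) (int (n + (j + k)))" by (simp add: regen_def memory_def ac_simps)
        then show ?thesis by blast
      qed
      then show "\<omega> \<in> X" using * by (simp add: X_def space_N)
    qed
    also have "\<dots> \<in> sets N" by measurable
    finally show "X \<in> sigma_sets (space M) (\<Union>(A ` {j..}))" by (simp add: N_def sub)
  qed
  then have 01: "prob X = 0 \<or> prob X = 1" by (rule kolmogorov_0_1_law[OF A indep])
  define F where "F n = {\<omega> \<in> space M. \<exists>k. regen (memory \<omega>) (int (n + k))}" for n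
  have F: "range F \<subseteq> events" unfolding F_def by auto
  have "decseq F"
  proof (rule decseq_SucI, rule subsetI)
    fix n \<omega> assume "\<omega> \<in> F (Suc n)"
    then obtain k where "\<omega> \<in> space M" "regen (memory \<omega>) (int (n + Suc k))" by (auto simp: F_def)
    then show "\<omega> \<in> F n" unfolding F_def by blast
  qed
  with F have "(\<lambda>n. prob (F n)) \<longlonglongrightarrow> prob (\<Inter>n. F n)" by (rule finite_Lim_measure_decseq)
  moreover have "(\<Inter>n. F n) = X" by (auto simp: F_def X_def)
  moreover have "regen_prob \<le> prob (F n)" for n
    unfolding prob_regen[of "int n", symmetric]
  proof (rule finite_measure_mono)
    show "{\<omega> \<in> space M. regen (memory \<omega>) (int n)} \<subseteq> F n"
      unfolding F_def by (auto intro: exI[of _ 0])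
  qed (use F in auto)
  ultimately have "regen_prob \<le> prob X" by (intro LIMSEQ_le_const) auto
  then have "prob X = 1" using 01 regen_prob_pos by auto
  then have "AE \<omega> in M. \<omega> \<in> X" by (rule AE_prob_1)
  then show ?thesis
  proof (eventually_elim, intro allI)
    fix \<omega> n assume "\<omega> \<in> X"
    then obtain k where "regen (memory \<omega>) (int (nat n + k))" unfolding X_def by blast
    then show "\<exists>z\<ge>n. regen (memory \<omega>) z" by (intro exI[of _ "int (nat n + k)"]) auto
  qed
qed

text \<open>By independence and equality of the marginals, a path and its translate by
  \<open>h\<close> have the same product law; translation by \<open>h\<close> carries one event to
  the other.\<close>

lemma prob_no_regen_shift:
  "prob {\<omega> \<in> space M. \<forall>z\<le>h. \<not> regen (memory \<omega>) z} = prob {\<omega> \<in> space M. \<forall>z\<le>0. \<not> regen (memory \<omega>) z}"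
proof -
  let ?P = "PiM UNIV (\<lambda>_. count_space UNIV) :: (int \<Rightarrow> nat) measure"
  let ?E = "{l \<in> space ?P. \<forall>z\<le>0. \<not> regen l z}"
  have law: "distr M (count_space UNIV) (L m) = distr M (count_space UNIV) (L n)" for m n
    by (rule measure_eqI_countable[of _ UNIV])
      (simp_all add: emeasure_distr emeasure_eq_measure vimage_def Int_def conj_commute L_law)
  have "distr M ?P (\<lambda>\<omega> n. L (n + h) \<omega>) = PiM UNIV (\<lambda>n. distr M (count_space UNIV) (L (n + h)))"
    using indep_vars_iff_distr_eq_PiM[where I = UNIV and M' = "\<lambda>_. count_space UNIV" and X = "\<lambda>n. L (n + h)"]
      indep_vars_L_reindex[of "\<lambda>n. n + h"] by (simp add: inj_def restrict_UNIV)
  also have "\<dots> = PiM UNIV (\<lambda>n. distr M (count_space UNIV) (L n))"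
    by (intro PiM_cong refl law)
  also have "\<dots> = distr M ?P memory"
    using indep_vars_iff_distr_eq_PiM[where I = UNIV and M' = "\<lambda>_. count_space UNIV" and X = L] L_indep
    by (simp add: memory_def[abs_def] restrict_UNIV)
  finally have eq: "distr M ?P (\<lambda>\<omega> n. L (n + h) \<omega>) = distr M ?P memory" .
  have E: "?E \<in> sets ?P" by measurable
  have shift: "(\<lambda>\<omega> n. L (n + h) \<omega>) \<in> measurable M ?P"
    by (rule measurable_PiM_single') auto
  have regen_shift: "regen (\<lambda>n. L (n + h) \<omega>) z \<longleftrightarrow> regen (memory \<omega>) (z + h)" for \<omega> z
    by (simp add: regen_def memory_def ac_simps)
  have "measure (distr M ?P (\<lambda>\<omega> n. L (n + h) \<omega>)) ?E = prob {\<omega> \<in> space M. \<forall>z\<le>h. \<not> regen (memory \<omega>) z}"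
  proof -
    have "(\<forall>z\<le>0. \<not> regen (memory \<omega>) (z + h)) \<longleftrightarrow> (\<forall>z\<le>h. \<not> regen (memory \<omega>) z)" for \<omega>
      by (metis add_le_cancel_right add.left_neutral diff_add_cancel)
    then show ?thesis
      unfolding measure_distr[OF shift E]
      by (intro arg_cong[where f = prob]) (auto simp: space_PiM regen_shift)
  qed
  moreover have "measure (distr M ?P memory) ?E = prob {\<omega> \<in> space M. \<forall>z\<le>0. \<not> regen (memory \<omega>) z}"
    unfolding measure_distr[OF memory_measurable E]
    by (intro arg_cong[where f = prob]) (auto simp: space_PiM)
  ultimately show ?thesis using eq by simp
qed

text \<open>The events \<open>F n\<close> decrease to the absence of any regeneration time, which is
  null by \<open>AE_regen_after\<close>. Their probabilities are equal by stationarity, hence all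
  zero.\<close>

lemma AE_regen_before: "AE \<omega> in M. \<forall>n. \<exists>z\<le>n. regen (memory \<omega>) z"
proof -
  define F where "F n = {\<omega> \<in> space M. \<forall>z\<le>int n. \<not> regen (memory \<omega>) z}" for n
  have F: "range F \<subseteq> events" unfolding F_def by auto
  have "decseq F" unfolding decseq_def F_def by fastforce
  with F have "(\<lambda>n. prob (F n)) \<longlonglongrightarrow> prob (\<Inter>n. F n)" by (rule finite_Lim_measure_decseq)
  moreover have "prob (\<Inter>n. F n) = 0"
  proof -
    have "(\<Inter>n. F n) \<in> events" using F by auto
    moreover have "AE \<omega> in M. \<omega> \<notin> (\<Inter>n. F n)"
      using AE_regen_after
    proof eventually_elim
      case (elim \<omega>)
      then obtain z where "regen (memory \<omega>) z" by blast
      then have "\<omega> \<notin> F (nat z)" by (auto simp: F_def intro!: exI[of _ z])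
      then show ?case by blast
    qed
    ultimately show ?thesis by (simp add: prob_eq_0)
  qed
  moreover have "(\<lambda>n. prob (F n)) = (\<lambda>n. prob (F 0))"
  proof
    fix n show "prob (F n) = prob (F 0)"
      using prob_no_regen_shift[of "int n"] by (simp add: F_def)
  qed
  ultimately have "(\<lambda>n::nat. prob (F 0)) \<longlonglongrightarrow> 0" by simp
  then have "prob (F 0) = 0" by (simp only: LIMSEQ_const_iff)
  then have *: "prob {\<omega> \<in> space M. \<forall>z\<le>n. \<not> regen (memory \<omega>) z} = 0" for n
    using prob_no_regen_shift[of n] by (simp add: F_def)
  have "AE \<omega> in M. \<not> (\<forall>z\<le>n. \<not> regen (memory \<omega>) z)" for n
    using *[of n] by (subst (asm) prob_eq_0) auto
  then show ?thesis by (simp add: AE_all_countable)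
qed

lemma AE_recurrent: "AE \<omega> in M. recurrent (memory \<omega>)"
  using AE_regen_after AE_regen_before by eventually_elim (simp add: recurrent_def)

end

subsection \<open>Independence of the cycles\<close>

text \<open>The later start \<open>t\<close> is a regeneration time and cannot lie strictly inside
  \<open>v\<close>. This makes different placements of the cycle around the origin mutually
  exclusive.\<close>

lemma cycles_from_overlap:
  assumes "cycles_from l s (v # vs)" "cycles_from l t (w # ws)" "s < t"
  shows "s + int (length v) \<le> t"
proof (rule ccontr)
  assume "\<not> s + int (length v) \<le> t"
  moreover have "regen l (s + int (length v))" "segment l s (length v) \<in> cycle_words" "0 < length v"
    using assms(1) cycles_from_regen by (auto simp: cycle_words_def)
  ultimately show False
    using segment_in_cycle_words_iff[of l s "length v"] cycles_from_regen[OF assms(2)] assms(3) by auto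
qed

context iid_memories
begin

definition cycle_of :: "int \<Rightarrow> 'c \<Rightarrow> nat list" where
  "cycle_of j \<omega> = word (memory \<omega>) (regen_time_int (memory \<omega>)) j"

text \<open>The whole factor \<open>regen_prob * length v\<close> of the joint mass is assigned to
  index 0; with this choice every factor has total mass 1.\<close>

definition cycle_mass :: "int \<Rightarrow> nat list \<Rightarrow> real" where
  "cycle_mass j v = (if v \<in> cycle_words
     then prod_list (map p v) * (if j = 0 then regen_prob * real (length v) else 1) else 0)"

lemma cycle_mass_nonneg: "0 \<le> cycle_mass j v"
proof -
  have "0 \<le> prod_list (map p v)" by (induction v) (auto simp: p_nonneg)
  then show ?thesis using regen_prob_pos by (simp add: cycle_mass_def)
qed

text \<open>The two random endpoints take countably many values, so each can be frozen in
  turn.\<close>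

lemma cycle_of_measurable [measurable]: "cycle_of j \<in> measurable M (count_space UNIV)"
proof -
  have 1: "(\<lambda>\<omega>. segment (memory \<omega>) s n) \<in> measurable M (count_space UNIV)" for s n
    unfolding segment_def memory_def by (rule measurable_map_countable) simp
  have 2: "(\<lambda>\<omega>. segment (memory \<omega>) s (nat (regen_time_int (memory \<omega>) (j + 1) - s)))
      \<in> measurable M (count_space UNIV)" for s
    by (rule measurable_compose_countable[where f = "\<lambda>t \<omega>. segment (memory \<omega>) s (nat (t - s))"])
      (rule 1, rule regen_time_int_memory_measurable)
  show ?thesis
    unfolding cycle_of_def[abs_def] word_def
    by (rule measurable_compose_countable[where f = "\<lambda>s \<omega>. segment (memory \<omega>) s
        (nat (regen_time_int (memory \<omega>) (j + 1) - s))"])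
      (rule 2, rule regen_time_int_memory_measurable)
qed

text \<open>The event splits into \<open>length v\<close> disjoint placements, whose probability
  does not depend on the position.\<close>

lemma prob_cycles_around_zero:
  "prob {\<omega> \<in> space M. \<forall>k<length (us @ v # vs). cycle_of (int k - int (length us)) \<omega> = (us @ v # vs) ! k} =
     (if set (us @ v # vs) \<subseteq> cycle_words
      then real (length v) * ((\<Prod>w\<leftarrow>us @ v # vs. prod_list (map p w)) * regen_prob) else 0)"
proof -
  define m where "m = int (length (concat us))"
  define E where "E t = {\<omega> \<in> space M. cycles_from (memory \<omega>) (t - m) (us @ v # vs)}" for t
  let ?I = "{- int (length v)<..0}"
  have E: "E t \<in> events" for t unfolding E_def by measurable
  have "disjoint_family_on E ?I"
  proof -
    have "\<not> (s < t \<and> \<omega> \<in> E s \<and> \<omega> \<in> E t)" if "s \<in> ?I" "t \<in> ?I" for s t \<omega>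
      using that cycles_from_overlap[of "memory \<omega>" s v vs t v vs]
      by (auto simp: E_def cycles_from_append m_def)
    then show ?thesis unfolding disjoint_family_on_def by (metis disjoint_iff linorder_neqE)
  qed
  then have "prob (\<Union>t\<in>?I. E t) = (\<Sum>t\<in>?I. prob (E t))"
    using E by (intro finite_measure_finite_Union) auto
  also have "\<dots> = (if set (us @ v # vs) \<subseteq> cycle_words
      then real (length v) * ((\<Prod>w\<leftarrow>us @ v # vs. prod_list (map p w)) * regen_prob) else 0)"
    unfolding E_def prob_cycles_from by simp
  also have "prob (\<Union>t\<in>?I. E t) = prob {\<omega> \<in> space M.
      \<forall>k<length (us @ v # vs). cycle_of (int k - int (length us)) \<omega> = (us @ v # vs) ! k}"
  \<comment> \<open>The two events are compared on recurrent paths, where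
    \<open>regen_time_int\<close> does enumerate the regeneration times.\<close>
  proof (rule finite_measure_eq_AE)
    show "AE \<omega> in M. (\<omega> \<in> (\<Union>t\<in>?I. E t)) = (\<omega> \<in> {\<omega> \<in> space M.
        \<forall>k<length (us @ v # vs). cycle_of (int k - int (length us)) \<omega> = (us @ v # vs) ! k})"
      using AE_recurrent AE_space
    proof eventually_elim
      case (elim \<omega>)
      then show ?case
        using words_around_zero_iff[OF enumerates_regen_time[OF elim(1)], of us v vs]
        by (simp add: E_def cycle_of_def m_def)
    qed
    show "(\<Union>t\<in>?I. E t) \<in> events" using E by auto
  qed measurable
  finally show ?thesis by simp
qed

lemma prob_cycles_window:
  "prob {\<omega> \<in> space M. \<forall>i\<in>{- int N..int N}. cycle_of i \<omega> = v i} = (\<Prod>i\<in>{- int N..int N}. cycle_mass i (v i))"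
proof -
  let ?I = "{- int N..int N}"
  let ?us = "map v [- int N..- 1]" and ?vs = "map v [1..int N]"
  let ?w = "?us @ v 0 # ?vs"
  have w: "?w = map v [- int N..int N]"
    using upto_split3[of "- int N" 0 "int N"] by simp
  have len: "length ?w = 2 * N + 1" "length ?us = N" by auto
  have nth: "?w ! k = v (int k - int N)" if "k < 2 * N + 1" for k
    unfolding w using that by (subst nth_map) (auto simp: nth_upto)
  \<comment> \<open>Position \<open>k\<close> of the list carries the cycle with index
    \<open>k - N\<close>, so the entry \<open>v 0\<close> sits at position \<open>N\<close>.\<close>
  have "(\<forall>i\<in>?I. cycle_of i \<omega> = v i) \<longleftrightarrow>
      (\<forall>k<length ?w. cycle_of (int k - int (length ?us)) \<omega> = ?w ! k)" (is "?A \<longleftrightarrow> ?B") for \<omega>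
  proof
    assume A: ?A
    show ?B
    proof (intro allI impI)
      fix k assume "k < length ?w"
      then have k: "k < 2 * N + 1" using len by linarith
      then show "cycle_of (int k - int (length ?us)) \<omega> = ?w ! k"
        unfolding len nth[OF k] using A by auto
    qed
  next
    assume B: ?B
    show ?A
    proof
      fix i assume i: "i \<in> ?I"
      define k where "k = nat (i + int N)"
      have k: "k < 2 * N + 1" "int k - int N = i" using i by (auto simp: k_def)
      then have "cycle_of (int k - int (length ?us)) \<omega> = ?w ! k"
        using B len by (metis (no_types, lifting))
      then show "cycle_of i \<omega> = v i" unfolding len nth[OF k(1)] k(2) .
    qed
  qed
  then have "prob {\<omega> \<in> space M. \<forall>i\<in>?I. cycle_of i \<omega> = v i} =
      (if set ?w \<subseteq> cycle_words
       then real (length (v 0)) * ((\<Prod>w\<leftarrow>?w. prod_list (map p w)) * regen_prob) else 0)"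
    by (simp only: prob_cycles_around_zero)
  also have "\<dots> = (\<Prod>i\<in>?I. cycle_mass i (v i))"
  proof (cases "\<forall>i\<in>?I. v i \<in> cycle_words")
    case True
    then have "(\<Prod>i\<in>?I. cycle_mass i (v i)) =
        (\<Prod>i\<in>?I. prod_list (map p (v i))) * (\<Prod>i\<in>?I. if i = 0 then regen_prob * real (length (v 0)) else 1)"
      by (subst prod.distrib[symmetric]) (auto simp: cycle_mass_def intro!: prod.cong)
    also have "(\<Prod>i\<in>?I. if i = 0 then regen_prob * real (length (v 0)) else 1) = regen_prob * real (length (v 0))"
      by (subst prod.delta) auto
    also have "(\<Prod>i\<in>?I. prod_list (map p (v i))) = (\<Prod>w\<leftarrow>?w. prod_list (map p w))"
      unfolding w using prod.distinct_set_conv_list[of "[- int N..int N]" "\<lambda>i. prod_list (map p (v i))"]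
      by (simp add: comp_def)
    finally show ?thesis using True unfolding w by (auto simp: image_subset_iff)
  next
    case False
    then obtain i where i: "i \<in> ?I" "v i \<notin> cycle_words" by blast
    then have "(\<Prod>i\<in>?I. cycle_mass i (v i)) = 0"
      by (intro prod_zero bexI[of _ i]) (auto simp: cycle_mass_def)
    moreover have "\<not> set ?w \<subseteq> cycle_words" using False unfolding w by (auto simp: image_subset_iff)
    ultimately show ?thesis by (simp only: if_False)
  qed
  finally show ?thesis .
qed

text \<open>For index 0 the window with \<open>N = 0\<close> already exhibits the mass as a law. For
  the others, the events of regenerating at time 0 with first cycle \<open>v\<close> have
  probabilities \<open>cycle_mass j v * regen_prob\<close>; they sum to \<open>regen_prob\<close>,
  which cancels.\<close>

lemma cycle_mass_total: "(\<integral>\<^sup>+v. ennreal (cycle_mass j v) \<partial>count_space UNIV) = 1"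
proof (cases "j = 0")
  case True
  have "prob {\<omega> \<in> space M. cycle_of 0 \<omega> = v} = cycle_mass 0 v" for v
    using prob_cycles_window[of 0 "\<lambda>_. v"] by simp
  then have "(\<integral>\<^sup>+v. ennreal (cycle_mass 0 v) \<partial>count_space UNIV) =
      (\<integral>\<^sup>+v. emeasure M {\<omega> \<in> space M. True \<and> cycle_of 0 \<omega> = v} \<partial>count_space UNIV)"
    by (simp add: emeasure_eq_measure)
  also have "\<dots> = emeasure M {\<omega> \<in> space M. True}"
    by (rule nn_integral_emeasure_slices) auto
  finally show ?thesis using True by (simp add: emeasure_space_1)
next
  case False
  have "emeasure M {\<omega> \<in> space M. regen (memory \<omega>) 0 \<and> cycle_of 0 \<omega> = v} =
      ennreal (cycle_mass j v) * ennreal regen_prob" for v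
  proof -
    have "prob {\<omega> \<in> space M. regen (memory \<omega>) 0 \<and> cycle_of 0 \<omega> = v} =
        prob {\<omega> \<in> space M. cycles_from (memory \<omega>) 0 [v]}"
    proof (rule finite_measure_eq_AE)
      show "AE \<omega> in M. (\<omega> \<in> {\<omega> \<in> space M. regen (memory \<omega>) 0 \<and> cycle_of 0 \<omega> = v}) =
          (\<omega> \<in> {\<omega> \<in> space M. cycles_from (memory \<omega>) 0 [v]})"
        using AE_recurrent AE_space
      proof eventually_elim
        case (elim \<omega>)
        let ?T = "regen_time_int (memory \<omega>)"
        note T = enumerates_regen_time[OF elim(1)]
        \<comment> \<open>On this event the cycle with index 0 starts exactly at time 0, so no size
          bias appears.\<close>
        have "?T 0 = 0" if "regen (memory \<omega>) 0"
        proof (rule ccontr)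
          assume "?T 0 \<noteq> 0"
          then show False using that enumerates_gap[OF T, of 0 0] enumerates_zero[OF T] by simp
        qed
        then have "regen (memory \<omega>) 0 \<and> cycle_of 0 \<omega> = v \<longleftrightarrow> cycles_from (memory \<omega>) 0 [v]"
          using words_iff_cycles_from[OF T, of "[v]" 0] cycles_from_regen[of "memory \<omega>" 0 "[v]"]
          by (auto simp: cycle_of_def simp del: cycles_from.simps)
        then show ?case using elim by simp
      qed
    qed measurable
    also have "\<dots> = cycle_mass j v * regen_prob"
      using False by (simp add: prob_cycles_from cycle_mass_def del: cycles_from.simps)
    finally show ?thesis
      by (simp add: emeasure_eq_measure ennreal_mult'[symmetric] cycle_mass_nonneg)
  qed
  then have "(\<integral>\<^sup>+v. ennreal (cycle_mass j v) * ennreal regen_prob \<partial>count_space UNIV) =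
      (\<integral>\<^sup>+v. emeasure M {\<omega> \<in> space M. regen (memory \<omega>) 0 \<and> cycle_of 0 \<omega> = v} \<partial>count_space UNIV)"
    by simp
  also have "\<dots> = emeasure M {\<omega> \<in> space M. regen (memory \<omega>) 0}"
    by (rule nn_integral_emeasure_slices) auto
  also have "\<dots> = ennreal regen_prob"
    by (simp add: emeasure_eq_measure prob_regen)
  finally have "(\<integral>\<^sup>+v. ennreal (cycle_mass j v) \<partial>count_space UNIV) * ennreal regen_prob = 1 * ennreal regen_prob"
    by (simp add: nn_integral_multc)
  then show ?thesis using regen_prob_pos by (metis ennreal_eq_0_iff ennreal_neq_top mult_divide_eq_ennreal not_le)
qed

lemma cycle_joint:
  assumes "finite J"
  shows "\<exists>I. finite I \<and> J \<subseteq> I \<and>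
    (\<forall>v. prob {\<omega> \<in> space M. \<forall>i\<in>I. cycle_of i \<omega> = v i} = (\<Prod>i\<in>I. cycle_mass i (v i)))"
proof -
  \<comment> \<open>Half-width of a symmetric window containing \<open>J\<close>; the inserted 0
    covers empty \<open>J\<close>.\<close>
  define N where "N = nat (Max (insert 0 (abs ` J)))"
  have "J \<subseteq> {- int N..int N}"
  proof
    fix j assume "j \<in> J"
    then have "\<bar>j\<bar> \<le> Max (insert 0 (abs ` J))" using assms by (intro Max_ge) auto
    then show "j \<in> {- int N..int N}" unfolding N_def by auto
  qed
  then show ?thesis using prob_cycles_window[of N] by blast
qed

lemma prob_cycle: "prob {\<omega> \<in> space M. cycle_of j \<omega> = v} = cycle_mass j v"
  by (rule prob_eq_mass[OF cycle_of_measurable cycle_mass_nonneg cycle_mass_total cycle_joint])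

lemma indep_vars_cycle: "indep_vars (\<lambda>_. count_space UNIV) cycle_of UNIV"
  by (rule indep_vars_of_mass[OF cycle_of_measurable cycle_mass_nonneg cycle_mass_total cycle_joint])

lemma distr_cycle_eq:
  assumes "i \<noteq> 0" "j \<noteq> 0"
  shows "distr M (count_space UNIV) (cycle_of i) = distr M (count_space UNIV) (cycle_of j)"
  by (rule measure_eqI_countable[of _ UNIV])
    (use assms in \<open>simp_all add: emeasure_distr emeasure_eq_measure vimage_def Int_def conj_commute
      prob_cycle cycle_mass_def\<close>)

end

subsection \<open>Independence of the blocks\<close>

lemma string_law_cong:
  "(\<And>i. i < m \<Longrightarrow> l (t + int i) = l' (t' + int i)) \<Longrightarrow> string_law P0 K l t m = string_law P0 K l' t' m"
  by (induction m) (simp_all add: Let_def)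

text \<open>The word is moved to time 0, so the conditional law of a block given \<open>L\<close>
  becomes a fixed function of its own cycle. \<open>string_law_cong\<close> justifies the move: the
  law reads only the values of \<open>L\<close> within the block.\<close>

definition string_mass ::
    "(bool \<times> bool) pmf \<Rightarrow> (nat \<Rightarrow> (bool \<times> bool) list \<Rightarrow> (bool \<times> bool) pmf) \<Rightarrow>
     nat list \<Rightarrow> (bool \<times> bool) list \<Rightarrow> real" where
  "string_mass P0 K v s = pmf (string_law P0 K (\<lambda>n. v ! nat n) 0 (length v)) s"

lemma string_mass_segment:
  "string_mass P0 K (segment l t n) s = pmf (string_law P0 K l t n) s"
  unfolding string_mass_def by (subst string_law_cong[where l' = l and t' = t]) auto

context iid_memories
begin

text \<open>Integrating a conditional probability over the whole space removes the
  conditioning.\<close>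

lemma real_cond_exp_memory_int:
  assumes "A \<in> events"
  shows "(\<integral>\<omega>. real_cond_exp M (vimage_algebra (space M) memory (PiM UNIV (\<lambda>_. count_space UNIV)))
    (indicator A) \<omega> \<partial>M) = prob A"
proof -
  let ?F = "vimage_algebra (space M) memory (PiM UNIV (\<lambda>_. count_space UNIV))"
  have "subalgebra M ?F"
    unfolding subalgebra_def using measurable_sets[OF memory_measurable]
      measurable_space[OF memory_measurable]
    by (auto simp: sets_vimage_algebra2)
  then interpret finite_measure_subalgebra M ?F
    by unfold_locales
  show ?thesis
    using assms by (subst real_cond_exp_int(2))
      (auto intro!: integrable_real_indicator simp: less_top[symmetric])
qed

section \<open>Blocks generated conditionally on the memories\<close>

context
  fixes Xh Yh P0 K
  assumes blocks: "generated_blocks M L Xh Yh P0 K"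
begin

lemma block_measurable [measurable]: "block L Xh Yh j \<in> measurable M (count_space UNIV)"
proof -
  have [measurable]: "Xh n \<in> measurable M (count_space UNIV)" "Yh n \<in> measurable M (count_space UNIV)" for n
    using blocks by (auto simp: generated_blocks_def)
  have pair: "(\<lambda>\<omega>. (Xh n \<omega>, Yh n \<omega>)) \<in> measurable M (count_space UNIV)" for n
    by (rule measurable_compose_countable[where f = "\<lambda>a \<omega>. (a, Yh n \<omega>)" and g = "Xh n"]) measurable
  have 1: "(\<lambda>\<omega>. map (\<lambda>n. (Xh n \<omega>, Yh n \<omega>)) [s..regen_time_int (memory \<omega>) (j + 1) - 1])
      \<in> measurable M (count_space UNIV)" for s
    by (rule measurable_compose_countable[where f = "\<lambda>t \<omega>. map (\<lambda>n. (Xh n \<omega>, Yh n \<omega>)) [s..t - 1]"])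
      (rule measurable_map_countable, rule pair, rule regen_time_int_memory_measurable)
  show ?thesis
    unfolding block_def[abs_def] memory_def[symmetric]
    by (rule measurable_compose_countable[where f = "\<lambda>s \<omega>. map (\<lambda>n. (Xh n \<omega>, Yh n \<omega>))
        [s..regen_time_int (memory \<omega>) (j + 1) - 1]"])
      (rule 1, rule regen_time_int_memory_measurable)
qed

lemma string_mass_cycle_measurable [measurable]:
  "(\<lambda>\<omega>. string_mass P0 K (cycle_of j \<omega>) s) \<in> borel_measurable M"
  by (rule measurable_compose[OF cycle_of_measurable]) simp

text \<open>Given \<open>L\<close>, the probability is a product of functions of distinct cycles;
  the cycles are independent, so its expectation factorises.\<close>

lemma prob_blocks:
  assumes J: "finite J"
  shows "prob {\<omega> \<in> space M. \<forall>j\<in>J. block L Xh Yh j \<omega> = s j} =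
    (\<Prod>j\<in>J. \<integral>\<omega>. string_mass P0 K (cycle_of j \<omega>) (s j) \<partial>M)"
proof -
  let ?A = "{\<omega> \<in> space M. \<forall>j\<in>J. block L Xh Yh j \<omega> = s j}"
  let ?F = "vimage_algebra (space M) memory (PiM UNIV (\<lambda>_. count_space UNIV))"
  have A: "?A \<in> events" using J by measurable
  have "AE \<omega> in M. (\<forall>j. \<bar>regen_time (memory \<omega>) j\<bar> \<noteq> \<infinity>) \<longrightarrow>
      real_cond_exp M ?F (indicator ?A) \<omega> =
      (\<Prod>j\<in>J. pmf (string_law P0 K (memory \<omega>) (regen_time_int (memory \<omega>) j)
        (nat (regen_time_int (memory \<omega>) (j + 1) - regen_time_int (memory \<omega>) j))) (s j))"
    using blocks J unfolding generated_blocks_def memory_def[abs_def] by blast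
  \<comment> \<open>Almost sure recurrence discharges the proviso that all times are finite.\<close>
  then have eq: "AE \<omega> in M. real_cond_exp M ?F (indicator ?A) \<omega> =
      (\<Prod>j\<in>J. string_mass P0 K (cycle_of j \<omega>) (s j))"
    using AE_recurrent
  proof eventually_elim
    case (elim \<omega>)
    then show ?case
      by (simp add: regen_time_eq cycle_of_def word_def string_mass_segment)
  qed
  have "prob ?A = (\<integral>\<omega>. real_cond_exp M ?F (indicator ?A) \<omega> \<partial>M)"
    by (rule real_cond_exp_memory_int[OF A, symmetric])
  also have "\<dots> = (\<integral>\<omega>. (\<Prod>j\<in>J. string_mass P0 K (cycle_of j \<omega>) (s j)) \<partial>M)"
    by (rule integral_cong_AE[OF borel_measurable_cond_exp2 _ eq]) measurable
  also have "\<dots> = (\<Prod>j\<in>J. \<integral>\<omega>. string_mass P0 K (cycle_of j \<omega>) (s j) \<partial>M)"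
  proof (rule indep_vars_lebesgue_integral[OF J])
    show "indep_vars (\<lambda>_. borel) (\<lambda>j \<omega>. string_mass P0 K (cycle_of j \<omega>) (s j)) J"
      by (rule indep_vars_compose2[OF indep_vars_subset[OF indep_vars_cycle]]) auto
    show "integrable M (\<lambda>\<omega>. string_mass P0 K (cycle_of j \<omega>) (s j))" for j
      by (rule integrable_const_bound[where B = 1]) (auto simp: string_mass_def pmf_le_1)
  qed
  finally show ?thesis .
qed

lemma prob_block:
  "prob {\<omega> \<in> space M. block L Xh Yh j \<omega> = s} = (\<integral>\<omega>. string_mass P0 K (cycle_of j \<omega>) s \<partial>M)"
  using prob_blocks[of "{j}" "\<lambda>_. s"] by simp

lemma indep_vars_block: "indep_vars (\<lambda>_. count_space UNIV) (block L Xh Yh) UNIV"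
  by (rule indep_vars_countableI[OF block_measurable]) (simp only: prob_blocks prob_block)

lemma distr_block_eq:
  assumes "i \<noteq> 0" "j \<noteq> 0"
  shows "distr M (count_space UNIV) (block L Xh Yh i) = distr M (count_space UNIV) (block L Xh Yh j)"
proof (rule measure_eqI_countable[of _ UNIV])
  fix s
  \<comment> \<open>The mass of a block at \<open>s\<close> is the integral of one function, the
    same for all indices, against the law of the cycle, so equality of the cycle laws carries
    over.\<close>
  have "(\<integral>\<omega>. string_mass P0 K (cycle_of j \<omega>) s \<partial>M) =
      (\<integral>v. string_mass P0 K v s \<partial>distr M (count_space UNIV) (cycle_of j))" for j
    by (rule integral_distr[symmetric]) auto
  then have "prob {\<omega> \<in> space M. block L Xh Yh i \<omega> = s} = prob {\<omega> \<in> space M. block L Xh Yh j \<omega> = s}"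
    using distr_cycle_eq[OF assms] by (simp add: prob_block)
  then show "emeasure (distr M (count_space UNIV) (block L Xh Yh i)) {s} =
      emeasure (distr M (count_space UNIV) (block L Xh Yh j)) {s}"
    by (simp add: emeasure_distr emeasure_eq_measure vimage_def Int_def conj_commute)
qed simp_all

text \<open>Splitting the independent family into the indices \<open>{0}\<close> and
  \<open>- {0}\<close> gives independence of two restricted families; the sigma-algebra of the
  single block lies in that of the one-element family.\<close>

lemma indep_set_block:
  "indep_set
     (sets (vimage_algebra (space M) (block L Xh Yh 0) (count_space UNIV)))
     (sets (vimage_algebra (space M) (\<lambda>\<omega>. \<lambda>i\<in>- {0}. block L Xh Yh i \<omega>)
        (PiM (- {0}) (\<lambda>_. count_space UNIV))))"
proof -
  let ?r = "\<lambda>\<omega>. \<lambda>i\<in>{0}. block L Xh Yh i \<omega>"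
  let ?N = "vimage_algebra (space M) ?r (PiM {0} (\<lambda>_. count_space UNIV))"
  have "indep_var (PiM {0} (\<lambda>_. count_space UNIV)) ?r
      (PiM (- {0}) (\<lambda>_. count_space UNIV)) (\<lambda>\<omega>. \<lambda>i\<in>- {0}. block L Xh Yh i \<omega>)"
    by (rule indep_var_restrict[OF indep_vars_block]) auto
  then have indep: "indep_set (sets ?N) (sets (vimage_algebra (space M)
      (\<lambda>\<omega>. \<lambda>i\<in>- {0}. block L Xh Yh i \<omega>) (PiM (- {0}) (\<lambda>_. count_space UNIV))))"
    unfolding indep_var_eq sets_vimage_algebra by blast
  have "(\<lambda>\<omega>. ?r \<omega> 0) \<in> measurable ?N (count_space UNIV)"
    by (rule measurable_compose[OF measurable_vimage_algebra1 measurable_component_singleton])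
      (auto simp: space_PiM split: if_splits)
  then have "sets (vimage_algebra (space M) (block L Xh Yh 0) (count_space UNIV)) \<subseteq> sets ?N"
    by (intro sets_image_in_sets) simp_all
  then show ?thesis
    unfolding indep_set_def
    by (intro indep_sets_mono_sets[OF indep[unfolded indep_set_def]]) (auto split: bool.split)
qed

end

end

theorem theorem5:
  fixes MX :: "'a measure" and X :: "int \<Rightarrow> 'a \<Rightarrow> bool" and pX :: "past \<Rightarrow> bool pmf"
    and MY :: "'b measure" and Y :: "int \<Rightarrow> 'b \<Rightarrow> bool" and pY :: "past \<Rightarrow> bool pmf"
    and P0 :: "(bool \<times> bool) pmf"
    and K :: "nat \<Rightarrow> (bool \<times> bool) list \<Rightarrow> (bool \<times> bool) pmf"
    and M :: "'c measure" and L :: "int \<Rightarrow> 'c \<Rightarrow> nat"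
    and Xh Yh :: "int \<Rightarrow> 'c \<Rightarrow> bool"
  assumes X: "stationary_chain MX X pX"
    and Y: "stationary_chain MY Y pY"
    and ordering: "\<And>x y. x \<le> y \<Longrightarrow> pmf (pX x) True \<le> pmf (pY y) True"
    and continuity: "(\<lambda>k. max (\<beta> pX k) (\<beta> pY k)) \<longlonglongrightarrow> 0"
    and product: "convergent_prod (\<alpha> pX pY)" "prodinf (\<alpha> pX pY) > 0"
    and decomposition: "kernel_decomposition pX pY P0 K"
    and M: "prob_space M"
    and L_indep: "prob_space.indep_vars M (\<lambda>_. count_space UNIV) L UNIV"
    and L_law: "\<And>n k. measure M {\<omega> \<in> space M. L n \<omega> = k} = lam pX pY k"
    and blocks: "generated_blocks M L Xh Yh P0 K"
  shows "(AE \<omega> in M. \<forall>n. \<bar>regen_time (\<lambda>m. L m \<omega>) n\<bar> \<noteq> \<infinity>) \<and>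
     (AE \<omega> in M. (\<forall>n. regen_time (\<lambda>m. L m \<omega>) n < regen_time (\<lambda>m. L m \<omega>) (n + 1)) \<and>
        regen_time (\<lambda>m. L m \<omega>) 0 \<le> 0 \<and> 0 < regen_time (\<lambda>m. L m \<omega>) 1) \<and>
     prob_space.indep_vars M (\<lambda>_. count_space UNIV) (block L Xh Yh) (- {0}) \<and>
     (\<forall>i j. i \<noteq> 0 \<longrightarrow> j \<noteq> 0 \<longrightarrow>
        distr M (count_space UNIV) (block L Xh Yh i) =
        distr M (count_space UNIV) (block L Xh Yh j)) \<and>
     prob_space.indep_set M
       (sets (vimage_algebra (space M) (block L Xh Yh 0) (count_space UNIV)))
       (sets (vimage_algebra (space M) (\<lambda>\<omega>. \<lambda>i\<in>- {0}. block L Xh Yh i \<omega>)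
          (PiM (- {0}) (\<lambda>_. count_space UNIV))))"
proof -
  interpret prob_space M by (rule M)
  \<comment> \<open>The increments \<open>lam\<close> telescope, which identifies the product
    assumed positive with the one in \<open>iid_memories\<close>.\<close>
  have \<alpha>: "(\<lambda>m. \<Sum>k\<le>m. lam pX pY k) = \<alpha> pX pY"
  proof
    fix m show "(\<Sum>k\<le>m. lam pX pY k) = \<alpha> pX pY m"
      by (induction m) (simp_all add: lam_def)
  qed
  interpret iid_memories M L "lam pX pY"
    by unfold_locales (use L_indep L_law product in \<open>simp_all add: \<alpha>\<close>)
  have "AE \<omega> in M. \<forall>n. \<bar>regen_time (memory \<omega>) n\<bar> \<noteq> \<infinity>"
    using AE_recurrent by eventually_elim (simp add: regen_time_eq)
  moreover have "AE \<omega> in M. (\<forall>n. regen_time (memory \<omega>) n < regen_time (memory \<omega>) (n + 1)) \<and>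
      regen_time (memory \<omega>) 0 \<le> 0 \<and> 0 < regen_time (memory \<omega>) 1"
    using AE_recurrent
  proof eventually_elim
    case (elim \<omega>)
    then show ?case using enumerates_regen_time[OF elim] by (simp add: regen_time_eq enumerates_def)
  qed
  moreover have "indep_vars (\<lambda>_. count_space UNIV) (block L Xh Yh) (- {0})"
    by (rule indep_vars_subset[OF indep_vars_block[OF blocks]]) simp
  ultimately show ?thesis
    using distr_block_eq[OF blocks] indep_set_block[OF blocks] unfolding memory_def by blast
qed

end
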